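(* In the setting described in the context, with $f$ satisfying the stated regularity conditions, $\mathbf{h}$ satisfying the stated smoothness and rank conditions, and $(\hat{\boldsymbol\omega}_n,\hat{\boldsymbol\lambda}_n)$, $\hat{\boldsymbol\omega}_n=(\hat{\boldsymbol\phi}_n,\hat{\boldsymbol\psi}_n)$, the sequence of random vectors constructed in the context, one has, as $n\to\infty$, $$\sqrt{n}\begin{pmatrix}\hat{\boldsymbol\phi}_n-\boldsymbol\phi^*\\ \hat{\boldsymbol\psi}_n-\boldsymbol\psi^*\\ \hat{\boldsymbol\lambda}_n\end{pmatrix}\ \xrightarrow{d}\ \mathcal{N}_{s+t}\left(\begin{pmatrix}\mathbf{0}\\ \mathbf{0}\\ \mathbf{0}\end{pmatrix},\ \begin{pmatrix}\mathbf{P}_{11}&\mathbf{P}_{12}&\mathbf{0}\\ \mathbf{P}_{21}&\mathbf{P}_{22}&\mathbf{0}\\ \mathbf{0}&\mathbf{0}&-\mathbf{P}_{33}\end{pmatrix}\right).$$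
   Context: Setting. Let $r<s$ and $t$ be positive integers with $s-r\le t\le r$. The parameter is $\boldsymbol\omega=(\omega_1,\dots,\omega_s)^T=(\boldsymbol\phi,\boldsymbol\psi)$ with $\boldsymbol\phi=(\omega_1,\dots,\omega_r)^T$ and $\boldsymbol\psi=(\omega_{r+1},\dots,\omega_s)^T$. The data $\mathbf{x}=(x_1,\dots,x_n)^T$ are $n$ independent observations with density $f(x,\boldsymbol\phi^* )$, where $\boldsymbol\omega^*=(\boldsymbol\phi^*,\boldsymbol\psi^* )$ is the true parameter; the log-likelihood is $\ell(\mathbf{x},\boldsymbol\phi)=\sum_{i=1}^n\log f(x_i,\boldsymbol\phi)$ and depends only on $\boldsymbol\phi$. There are $t$ constraints $\mathbf{h}(\boldsymbol\omega)=(h_1(\boldsymbol\omega),\dots,h_t(\boldsymbol\omega))^T=\mathbf{0}$, and $\mathbf{h}(\boldsymbol\omega^* )=\mathbf{0}$. Notation. $\mathbf{s}(\mathbf{x},\boldsymbol\phi)\in\mathbb{R}^r$ is the score vector $(\partial\ell(\mathbf{x},\boldsymbol\phi)/\partial\omega_i)_{i\le r}$; $\mathbf{J}_{\boldsymbol\omega}$ is the $r\times t$ matrix $(\partial h_j(\boldsymbol\omega)/\partial\omega_i)_{i\le r,\,j\le t}$; $\mathbf{K}_{\boldsymbol\omega}$ is the $(s-r)\times t$ matrix $(\partial h_j(\boldsymbol\omega)/\partial\omega_{r+i})_{i\le s-r,\,j\le t}$; $\mathbf{M}_{\mathbf{x},\boldsymbol\phi}$ is the $r\times r$ matrix $(\partial^2\ell(\mathbf{x},\boldsymbol\phi)/\partial\omega_i\partial\omega_j)$.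 For $\rho>0$, $U_\rho=\{\boldsymbol\omega\in\mathbb{R}^s:\|\boldsymbol\omega-\boldsymbol\omega^*\|\le\rho\}$; $\alpha>0$ is fixed. Conditions on $f$ (Cramér-type, from Aitchison and Silvey 1958). For all $\boldsymbol\omega\in U_\alpha$ and almost all $x$, the partial derivatives of $\log f(x,\boldsymbol\phi)$ with respect to $\omega_1,\dots,\omega_r$ up to order three exist; the first and second order partial derivatives of $f(x,\boldsymbol\phi)$ are bounded in modulus, uniformly for $\boldsymbol\omega\in U_\alpha$, by integrable functions $F_1(x)$, $F_2(x)$; the third order partial derivatives of $\log f(x,\boldsymbol\phi)$ are bounded in modulus, uniformly for $\boldsymbol\omega\in U_\alpha$, by a function $F_3(x)$ with $\int F_3(x)f(x,\boldsymbol\phi^* )\,dx<\kappa_1<\infty$; and the Fisher information matrix $\mathbf{B}_{\boldsymbol\phi^*}=\left(\int \frac{\partial\log f(x,\boldsymbol\phi^* )}{\partial\omega_i}\frac{\partial\log f(x,\boldsymbol\phi^* )}{\partial\omega_j}f(x,\boldsymbol\phi^* )\,dx\right)_{i,j\le r}$ is finite and positive definite. These imply: for any positive $\delta<\alpha$ and $\epsilon<1$ there is $n(\delta,\epsilon)$ such that for every $n\ge n(\delta,\epsilon)$ there is a set $\mathbf{X}_n\subset\mathbb{R}^n$ with: (X1) $\Pr\{\mathbf{X}_n\}>1-\epsilon$; and for every $\mathbf{x}\in\mathbf{X}_n$ (for which $\ell(\mathbf{x},\cdot)$ has the derivatives above on $U_\alpha$): (X2) $\|\mathbf{s}(\mathbf{x},\boldsymbol\phi^*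 )/n\|<\delta^2$; (X3) $\mathbf{M}_{\mathbf{x},\boldsymbol\phi^*}/n=-\mathbf{B}_{\boldsymbol\phi^*}+\delta\,\mathbf{m}_{\mathbf{x},\boldsymbol\phi^*}$ where $\mathbf{m}_{\mathbf{x},\boldsymbol\phi^*}$ is an $r\times r$ matrix with entries of modulus at most $1$; (X4) $\left|\frac1n\frac{\partial^3\ell(\mathbf{x},\boldsymbol\phi)}{\partial\omega_i\partial\omega_j\partial\omega_k}\right|<2\kappa_1$ for all $\boldsymbol\omega\in U_\alpha$ and $i,j,k\le r$, with $\kappa_1$ a constant. Conditions on $\mathbf{h}$. For all $\boldsymbol\omega\in U_\alpha$ the first order partial derivatives of every $h_k$ exist and are continuous in $\boldsymbol\omega$; for all $\boldsymbol\omega\in U_\alpha$ the second order partial derivatives of every $h_k$ exist and are bounded in modulus by a constant $2\kappa_2$; $\operatorname{rank}(\mathbf{J}_{\boldsymbol\omega^*})=t$ and $\operatorname{rank}(\mathbf{K}_{\boldsymbol\omega^*})=s-r$. The matrices $\mathbf{P}_{ij}$. The $(s+t)\times(s+t)$ block matrix below is non-singular and $\mathbf{P}_{ij}$, $i,j=1,2,3$, are the blocks of its inverse, with block sizes $r,\ s-r,\ t$: $$\begin{pmatrix}\mathbf{P}_{11}&\mathbf{P}_{12}&\mathbf{P}_{13}\\ \mathbf{P}_{21}&\mathbf{P}_{22}&\mathbf{P}_{23}\\ \mathbf{P}_{31}&\mathbf{P}_{32}&\mathbf{P}_{33}\end{pmatrix}=\begin{pmatrix}\mathbf{B}_{\boldsymbol\phi^*}&\mathbf{0}&-\mathbf{J}_{\boldsymbol\omega^*}\\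 \mathbf{0}&\mathbf{0}&-\mathbf{K}_{\boldsymbol\omega^*}\\ -\mathbf{J}_{\boldsymbol\omega^*}^T&-\mathbf{K}_{\boldsymbol\omega^*}^T&\mathbf{0}\end{pmatrix}^{-1}.$$ The estimators. Let $(\delta_m)$, $(\epsilon_m)$ be decreasing sequences of positive reals tending to $0$, with $\epsilon_1<1$ and $\delta_1<\alpha$ small enough that, for every $\delta\le\delta_1$, every $\epsilon<1$ and every $\mathbf{x}$ in a set $\mathbf{X}_n$ with (X1)-(X4) for $\delta,\epsilon$, the system $$\tfrac1n \mathbf{s}(\mathbf{x},\boldsymbol{\phi})+\mathbf{J}_{\boldsymbol\omega}\boldsymbol\lambda=\mathbf{0},\qquad \mathbf{K}_{\boldsymbol\omega}\boldsymbol\lambda=\mathbf{0},\qquad \mathbf{h}(\boldsymbol\omega)=\mathbf{0}\qquad( * )$$ has a solution $(\boldsymbol\omega,\boldsymbol\lambda)$ with $\|\boldsymbol\omega-\boldsymbol\omega^*\|<\delta$ (such a $\delta_1$ exists). Let $(n_m)$ be a (strictly) increasing sequence of integers such that for every $n\ge n_m$ there is a set $\mathbf{X}_n$ with (X1)-(X4) for $\delta=\delta_m$, $\epsilon=\epsilon_m$. For $n_m\le n<n_{m+1}$, fix a set $\mathbf{X}_n$ with (X1)-(X4) for $\delta=\delta_m$, $\epsilon=\epsilon_m$. If $\mathbf{x}\in\mathbf{X}_n$, let $(\hat{\boldsymbol\omega}_n,\hat{\boldsymbol\lambda}_n)$ be a solution of $( * )$ with $\|\hat{\boldsymbol\omega}_n-\boldsymbol\omega^*\|<\delta_m$;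 if $\mathbf{x}\notin\mathbf{X}_n$, define $$\begin{pmatrix}\hat{\boldsymbol\phi}_n-\boldsymbol\phi^*\\ \hat{\boldsymbol\psi}_n-\boldsymbol\psi^*\\ \hat{\boldsymbol\lambda}_n\end{pmatrix}=\begin{pmatrix}\mathbf{P}_{11}&\mathbf{P}_{12}&\mathbf{P}_{13}\\ \mathbf{P}_{21}&\mathbf{P}_{22}&\mathbf{P}_{23}\\ \mathbf{P}_{31}&\mathbf{P}_{32}&\mathbf{P}_{33}\end{pmatrix}\begin{pmatrix}\tfrac1n\mathbf{s}(\mathbf{x},\boldsymbol\phi^* )\\ \mathbf{0}\\ \mathbf{0}\end{pmatrix}.$$ The solutions are understood to be selected so that $\hat{\boldsymbol\omega}_n,\hat{\boldsymbol\lambda}_n$ are random vectors (measurable functions of $\mathbf{x}$). $\mathcal{N}_{s+t}(\mu,\Sigma)$ denotes the (possibly degenerate) normal law on $\mathbb{R}^{s+t}$, and $\xrightarrow{d}$ convergence in distribution. *)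

theory Defs
  imports "HOL-Probability.Probability"
begin

section \<open>Iterated partial derivatives\<close>

text \<open>\<open>iter_partial [i, j, k] g a\<close> is the value at \<open>a\<close> of the derivative of \<open>g\<close> with respect to
  \<open>k\<close>, then \<open>j\<close>, then \<open>i\<close>. It is meaningful only where \<open>has_iter_partial [i, j, k] g a\<close> holds, which
  demands that the lower-order derivative exists near \<open>a\<close> on the line through \<open>a\<close> in direction \<open>i\<close>
  and is itself differentiable at \<open>a\<close> along that line.\<close>

primrec iter_partial :: "'i::finite list \<Rightarrow> (real^'i \<Rightarrow> real) \<Rightarrow> real^'i \<Rightarrow> real" where
  "iter_partial [] g = g"
| "iter_partial (i # js) g = (\<lambda>a. deriv (\<lambda>u. iter_partial js g (a + u *\<^sub>R axis i 1)) 0)"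

primrec has_iter_partial :: "'i::finite list \<Rightarrow> (real^'i \<Rightarrow> real) \<Rightarrow> real^'i \<Rightarrow> bool" where
  "has_iter_partial [] g = (\<lambda>a. True)"
| "has_iter_partial (i # js) g = (\<lambda>a.
     (\<forall>\<^sub>F u in nhds 0. has_iter_partial js g (a + u *\<^sub>R axis i 1)) \<and>
     (\<lambda>u. iter_partial js g (a + u *\<^sub>R axis i 1)) field_differentiable (at 0))"


section \<open>Normal laws and convergence in distribution\<close>

text \<open>The univariate normal law with mean \<open>m\<close> and variance \<open>v \<ge> 0\<close>; a point mass if \<open>v = 0\<close>.\<close>

definition normal_law :: "real \<Rightarrow> real \<Rightarrow> real measure" where
  "normal_law m v =
     (if v = 0 then return borel m
      else density lborel (\<lambda>x. ennreal (normal_density m (sqrt v) x)))"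

text \<open>The possibly degenerate normal law on \<open>\<real>\<^sup>k\<close>: every linear combination of the coordinates is
  univariate normal with the mean and variance prescribed by \<open>m\<close> and \<open>S\<close>. This determines \<open>N\<close>.
  Symmetry of \<open>S\<close> is required because the variances only see its symmetric part.\<close>

definition multivariate_normal ::
  "(real^'k::finite) measure \<Rightarrow> real^'k \<Rightarrow> real^'k^'k \<Rightarrow> bool" where
  "multivariate_normal N m S \<longleftrightarrow>
     prob_space N \<and> sets N = sets borel \<and> transpose S = S \<and>
     (\<forall>u. 0 \<le> u \<bullet> (S *v u) \<and>
          distr N borel (\<lambda>x. u \<bullet> x) = normal_law (u \<bullet> m) (u \<bullet> (S *v u)))"

text \<open>Weak convergence tested on bounded continuous functions; the library's \<open>weak_conv_m\<close>
  only covers measures on the real line.\<close>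

definition converges_weakly ::
  "(nat \<Rightarrow> 'a::topological_space measure) \<Rightarrow> 'a measure \<Rightarrow> bool" where
  "converges_weakly L N \<longleftrightarrow>
     (\<forall>g :: 'a \<Rightarrow> real. continuous_on UNIV g \<and> bounded (range g) \<longrightarrow>
        (\<lambda>n. \<integral>y. g y \<partial>L n) \<longlonglongrightarrow> (\<integral>y. g y \<partial>N))"


section \<open>The statistical model\<close>

text \<open>The parameter \<open>\<omega> = (\<phi>, \<psi>)\<close> lives in \<open>real^('r + 'q)\<close>, where \<open>r = CARD('r)\<close> and
  \<open>s - r = CARD('q)\<close>; there are \<open>t = CARD('t)\<close> constraints. The density is \<open>f x \<phi>\<close> with respect to
  Lebesgue measure on the line, and a sample of size \<open>n\<close> is \<open>x 0, \<dots>, x (n - 1)\<close>.\<close>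

definition phi_part :: "real^('r::finite + 'q::finite) \<Rightarrow> real^'r" where
  "phi_part w = (\<chi> i. w $ Inl i)"

definition obs_law :: "(real \<Rightarrow> real^'r::finite \<Rightarrow> real) \<Rightarrow> real^'r \<Rightarrow> real measure" where
  "obs_law f p = density lborel (\<lambda>x. ennreal (f x p))"

definition sample_law :: "(real \<Rightarrow> real^'r::finite \<Rightarrow> real) \<Rightarrow> real^'r \<Rightarrow> nat \<Rightarrow> (nat \<Rightarrow> real) measure" where
  "sample_law f p n = Pi\<^sub>M {..<n} (\<lambda>_. obs_law f p)"

definition loglik :: "(real \<Rightarrow> real^'r::finite \<Rightarrow> real) \<Rightarrow> nat \<Rightarrow> (nat \<Rightarrow> real) \<Rightarrow> real^'r \<Rightarrow> real" where
  "loglik f n x p = (\<Sum>k<n. ln (f (x k) p))"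

definition score :: "(real \<Rightarrow> real^'r::finite \<Rightarrow> real) \<Rightarrow> nat \<Rightarrow> (nat \<Rightarrow> real) \<Rightarrow> real^'r \<Rightarrow> real^'r" where
  "score f n x p = (\<chi> i. iter_partial [i] (loglik f n x) p)"

definition hess :: "(real \<Rightarrow> real^'r::finite \<Rightarrow> real) \<Rightarrow> nat \<Rightarrow> (nat \<Rightarrow> real) \<Rightarrow> real^'r \<Rightarrow> real^'r^'r" where
  "hess f n x p = (\<chi> i j. iter_partial [i, j] (loglik f n x) p)"

definition fisher :: "(real \<Rightarrow> real^'r::finite \<Rightarrow> real) \<Rightarrow> real^'r \<Rightarrow> real^'r^'r" where
  "fisher f p = (\<chi> i j. \<integral>x. iter_partial [i] (\<lambda>q. ln (f x q)) p
                          * iter_partial [j] (\<lambda>q. ln (f x q)) p * f x p \<partial>lborel)"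

definition jacJ ::
  "(real^('r::finite + 'q::finite) \<Rightarrow> real^'t::finite) \<Rightarrow> real^('r + 'q) \<Rightarrow> real^'t^'r" where
  "jacJ h w = (\<chi> i j. iter_partial [Inl i] (\<lambda>v. h v $ j) w)"

definition jacK ::
  "(real^('r::finite + 'q::finite) \<Rightarrow> real^'t::finite) \<Rightarrow> real^('r + 'q) \<Rightarrow> real^'t^'q" where
  "jacK h w = (\<chi> i j. iter_partial [Inr i] (\<lambda>v. h v $ j) w)"

text \<open>The projection of \<open>U\<^sub>\<alpha>\<close> to the first \<open>r\<close> coordinates is \<open>cball p \<alpha>\<close>, so conditions involving
  only \<open>\<phi>\<close> are stated there. Almost-everywhere null sets do not depend on the parameter. Statements
  about \<open>log f\<close> are for almost all \<open>x\<close> under the true law (so the support need not be the whole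
  line) and carry \<open>f > 0\<close> explicitly, as \<open>ln\<close> is a total function; statements about \<open>f\<close> are for
  Lebesgue-almost all \<open>x\<close>.\<close>

definition density_conditions ::
  "(real \<Rightarrow> real^'r::finite \<Rightarrow> real) \<Rightarrow> real^'r \<Rightarrow> real \<Rightarrow> real \<Rightarrow> bool" where
  "density_conditions f p \<alpha> \<kappa>\<^sub>1 \<longleftrightarrow>
     (\<forall>q\<in>cball p \<alpha>. (\<lambda>x. f x q) \<in> borel_measurable borel \<and> (\<forall>x. 0 \<le> f x q) \<and>
        prob_space (obs_law f q)) \<and>
     (AE x in obs_law f p. \<forall>q\<in>cball p \<alpha>. 0 < f x q \<and>
        (\<forall>js. length js \<le> 3 \<longrightarrow> has_iter_partial js (\<lambda>q. ln (f x q)) q)) \<and>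
     (\<exists>F\<^sub>1 F\<^sub>2. integrable lborel F\<^sub>1 \<and> integrable lborel F\<^sub>2 \<and>
        (AE x in lborel. \<forall>q\<in>cball p \<alpha>. \<forall>i j.
           has_iter_partial [i] (f x) q \<and> \<bar>iter_partial [i] (f x) q\<bar> \<le> F\<^sub>1 x \<and>
           has_iter_partial [i, j] (f x) q \<and> \<bar>iter_partial [i, j] (f x) q\<bar> \<le> F\<^sub>2 x)) \<and>
     (\<exists>F\<^sub>3. (AE x in obs_law f p. \<forall>q\<in>cball p \<alpha>. \<forall>i j k.
              \<bar>iter_partial [i, j, k] (\<lambda>q. ln (f x q)) q\<bar> \<le> F\<^sub>3 x) \<and>
        integrable lborel (\<lambda>x. F\<^sub>3 x * f x p) \<and> (\<integral>x. F\<^sub>3 x * f x p \<partial>lborel) < \<kappa>\<^sub>1) \<and>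
     (\<forall>i j. integrable lborel (\<lambda>x. iter_partial [i] (\<lambda>q. ln (f x q)) p
                                * iter_partial [j] (\<lambda>q. ln (f x q)) p * f x p)) \<and>
     (\<forall>v. v \<noteq> 0 \<longrightarrow> 0 < v \<bullet> (fisher f p *v v))"

definition constraint_conditions ::
  "(real^('r::finite + 'q::finite) \<Rightarrow> real^'t::finite) \<Rightarrow> real^('r + 'q) \<Rightarrow> real \<Rightarrow> real \<Rightarrow> bool" where
  "constraint_conditions h w \<alpha> \<kappa>\<^sub>2 \<longleftrightarrow>
     (\<forall>k a. (\<forall>v\<in>cball w \<alpha>. has_iter_partial [a] (\<lambda>v. h v $ k) v) \<and>
            continuous_on (cball w \<alpha>) (iter_partial [a] (\<lambda>v. h v $ k))) \<and>
     (\<forall>k a b. \<forall>v\<in>cball w \<alpha>. has_iter_partial [a, b] (\<lambda>v. h v $ k) v \<and>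
            \<bar>iter_partial [a, b] (\<lambda>v. h v $ k) v\<bar> \<le> 2 * \<kappa>\<^sub>2) \<and>
     rank (jacJ h w) = CARD('t) \<and> rank (jacK h w) = CARD('q)"

text \<open>Sets of samples of size \<open>n\<close> satisfying (X1)--(X4) for \<open>\<delta>\<close>, \<open>\<epsilon>\<close>.\<close>

definition good_sample_set ::
  "(real \<Rightarrow> real^'r::finite \<Rightarrow> real) \<Rightarrow> real^'r \<Rightarrow> real \<Rightarrow> real \<Rightarrow> real \<Rightarrow> real \<Rightarrow> nat \<Rightarrow> (nat \<Rightarrow> real) set \<Rightarrow> bool" where
  "good_sample_set f p \<alpha> \<kappa>\<^sub>1 \<delta> \<epsilon> n X \<longleftrightarrow>
     X \<in> sets (sample_law f p n) \<and>
     measure (sample_law f p n) X > 1 - \<epsilon> \<and>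
     (\<forall>x\<in>X.
        (\<forall>q\<in>cball p \<alpha>. (\<forall>k<n. 0 < f (x k) q) \<and>
           (\<forall>js. length js \<le> 3 \<longrightarrow> has_iter_partial js (loglik f n x) q)) \<and>
        norm (score f n x p /\<^sub>R real n) < \<delta>\<^sup>2 \<and>
        (\<exists>m :: real^'r^'r. (\<forall>i j. \<bar>m $ i $ j\<bar> \<le> 1) \<and>
           hess f n x p /\<^sub>R real n = - fisher f p + \<delta> *\<^sub>R m) \<and>
        (\<forall>q\<in>cball p \<alpha>. \<forall>i j k. \<bar>iter_partial [i, j, k] (loglik f n x) q / real n\<bar> < 2 * \<kappa>\<^sub>1))"

definition likelihood_equations ::
  "(real \<Rightarrow> real^'r::finite \<Rightarrow> real) \<Rightarrow> (real^('r + 'q::finite) \<Rightarrow> real^'t::finite) \<Rightarrow> nat \<Rightarrow> (nat \<Rightarrow> real)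
     \<Rightarrow> real^('r + 'q) \<Rightarrow> real^'t \<Rightarrow> bool" where
  "likelihood_equations f h n x w l \<longleftrightarrow>
     score f n x (phi_part w) /\<^sub>R real n + jacJ h w *v l = 0 \<and>
     jacK h w *v l = 0 \<and>
     h w = 0"


section \<open>Block vectors and matrices\<close>

definition stack :: "real^'a::finite \<Rightarrow> real^'b::finite \<Rightarrow> real^('a + 'b)" where
  "stack u v = (\<chi> a. case a of Inl i \<Rightarrow> u $ i | Inr j \<Rightarrow> v $ j)"

definition info_block ::
  "real^'r^'r \<Rightarrow> real^'t^'r \<Rightarrow> real^'t^'q
     \<Rightarrow> real^(('r::finite + 'q::finite) + 't::finite)^(('r + 'q) + 't)" where
  "info_block B J K = (\<chi> a b. case (a, b) of
       (Inl (Inl i), Inl (Inl j)) \<Rightarrow> B $ i $ j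
     | (Inl (Inl i), Inr k) \<Rightarrow> - J $ i $ k
     | (Inl (Inr i), Inr k) \<Rightarrow> - K $ i $ k
     | (Inr k, Inl (Inl i)) \<Rightarrow> - J $ i $ k
     | (Inr k, Inl (Inr i)) \<Rightarrow> - K $ i $ k
     | _ \<Rightarrow> 0)"

text \<open>The matrix \<open>P\<close> of blocks \<open>P\<^sub>i\<^sub>j\<close>. The matrix inverted is non-singular under the rank
  conditions and positive definiteness of the Fisher information.\<close>

definition P_matrix ::
  "(real \<Rightarrow> real^'r::finite \<Rightarrow> real) \<Rightarrow> (real^('r + 'q::finite) \<Rightarrow> real^'t::finite) \<Rightarrow> real^('r + 'q)
     \<Rightarrow> real^(('r + 'q) + 't)^(('r + 'q) + 't)" where
  "P_matrix f h w = matrix_inv (info_block (fisher f (phi_part w)) (jacJ h w) (jacK h w))"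

definition asymp_cov ::
  "real^('a::finite + 'b::finite)^('a + 'b) \<Rightarrow> real^('a + 'b)^('a + 'b)" where
  "asymp_cov P = (\<chi> a b. case (a, b) of
       (Inl i, Inl j) \<Rightarrow> P $ Inl i $ Inl j
     | (Inr k, Inr l) \<Rightarrow> - P $ Inr k $ Inr l
     | _ \<Rightarrow> 0)"

end

theory Submission
  imports Defs
begin

text \<open>Expanding the likelihood equations about \<open>\<omega>\<^sup>*\<close> shows that \<open>z = (\<omega> - \<omega>\<^sup>*, \<lambda>)\<close> solves
  \<open>A z = (s / n, 0, 0) + e\<close>, where \<open>A\<close> is the matrix inverted by \<open>P\<close> and \<open>|e| \<le> C \<delta> |z|\<close>; for small \<open>\<delta>\<close>
  this gives \<open>|z - P (s / n, 0, 0)| \<le> C' \<delta> |s| / n\<close>. Outside the good sample sets the difference is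
  zero by construction, so after scaling by \<open>\<surd>n\<close> the estimator differs from a linear image of the
  normalized score by at most \<open>C' \<delta>\<close> times a random variable with bounded first moment. This
  transfers the limit of characteristic functions, given in each direction by the univariate
  central limit theorem, and also yields tightness. The limiting variance in direction \<open>u\<close> is
  \<open>x \<bullet> B x\<close> with \<open>x\<close> the first block of \<open>P u\<close>, which the block equations of \<open>A\<close> turn into the stated
  quadratic form.\<close>

section \<open>Weak convergence from characteristic functions\<close>

text \<open>No bound on the multipliers \<lambda> is available beforehand, yet the change of the
  first derivatives of h between \<omega>* and \<omega> acts on \<lambda>. The residual is therefore
  measured by the whole of z, multipliers included; being proportional to z with a small factor, it
  can be absorbed, and the size of z then comes out in terms of the score. The factor is
  deterministic, so all randomness sits in the normalized score, whose first moment is bounded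
  uniformly in n through its second moment. Closeness is carried as an almost sure bound by a small
  constant times an integrable variable, because that one form serves twice: e^(ia) is 1-Lipschitz
  in a, which compares characteristic functions, and Markov's inequality gives tightness. The limit
  covariance has rank at most r in dimension s + t, so it is singular and no density is at hand. The
  limit law is built instead as a linear image of independent standard normals. Knowing the limit in
  advance leaves only a continuity theorem to prove: bounded continuous functions are approximated
  by trigonometric polynomials on a ball carrying most of the mass.\<close>

inductive trig_poly :: "('a::real_inner \<Rightarrow> real) \<Rightarrow> bool" where
  cos: "trig_poly (\<lambda>x. cos (u \<bullet> x))"
| sin: "trig_poly (\<lambda>x. sin (u \<bullet> x))"
| scale: "trig_poly p \<Longrightarrow> trig_poly (\<lambda>x. c * p x)"
| add: "trig_poly p \<Longrightarrow> trig_poly q \<Longrightarrow> trig_poly (\<lambda>x. p x + q x)"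

lemma trig_poly_const: "trig_poly (\<lambda>x. c)"
  using trig_poly.scale[OF trig_poly.cos[of 0], of c] by simp

text \<open>The product-to-sum formulas keep products inside the linear span. Closure under products
  is derived instead of being an introduction rule, since convergence of integrals passes only to
  sums and multiples, while Stone-Weierstrass needs an algebra.\<close>

lemma trig_poly_mult_cos: "trig_poly p \<Longrightarrow> trig_poly (\<lambda>x. cos (u \<bullet> x) * p x)"
proof (induction rule: trig_poly.induct)
  case (cos v)
  have "trig_poly (\<lambda>x. (1/2) * (cos ((u - v) \<bullet> x) + cos ((u + v) \<bullet> x)))"
    by (intro trig_poly.intros)
  then show ?case by (simp add: cos_times_cos inner_diff_left inner_add_left)
next
  case (sin v)
  have "trig_poly (\<lambda>x. (1/2) * (sin ((u + v) \<bullet> x) + (-1) * sin ((u - v) \<bullet> x)))"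
    by (intro trig_poly.intros)
  then show ?case by (simp add: cos_times_sin inner_diff_left inner_add_left)
next
  case (scale p c)
  then show ?case using trig_poly.scale[of "\<lambda>x. cos (u \<bullet> x) * p x" c] by (simp add: mult_ac)
next
  case (add p q)
  then show ?case using trig_poly.add by (force simp: distrib_left)
qed

lemma trig_poly_mult_sin: "trig_poly p \<Longrightarrow> trig_poly (\<lambda>x. sin (u \<bullet> x) * p x)"
proof (induction rule: trig_poly.induct)
  case (cos v)
  have "trig_poly (\<lambda>x. (1/2) * (sin ((u + v) \<bullet> x) + sin ((u - v) \<bullet> x)))"
    by (intro trig_poly.intros)
  then show ?case by (simp add: sin_times_cos inner_diff_left inner_add_left)
next
  case (sin v)
  have "trig_poly (\<lambda>x. (1/2) * (cos ((u - v) \<bullet> x) + (-1) * cos ((u + v) \<bullet> x)))"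
    by (intro trig_poly.intros)
  then show ?case by (simp add: sin_times_sin inner_diff_left inner_add_left)
next
  case (scale p c)
  then show ?case using trig_poly.scale[of "\<lambda>x. sin (u \<bullet> x) * p x" c] by (simp add: mult_ac)
next
  case (add p q)
  then show ?case using trig_poly.add by (force simp: distrib_left)
qed

lemma trig_poly_mult: "trig_poly p \<Longrightarrow> trig_poly q \<Longrightarrow> trig_poly (\<lambda>x. p x * q x)"
proof (induction rule: trig_poly.induct)
  case (scale p c)
  then show ?case using trig_poly.scale[of "\<lambda>x. p x * q x" c] by (simp add: mult_ac)
next
  case (add p p')
  then show ?case using trig_poly.add by (force simp: distrib_right)
qed (simp_all add: trig_poly_mult_cos trig_poly_mult_sin)

lemma trig_poly_continuous: "trig_poly p \<Longrightarrow> continuous_on A p"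
  by (induction rule: trig_poly.induct)
    (auto intro!: continuous_on_cos continuous_on_sin continuous_on_mult
      continuous_on_add continuous_on_inner continuous_on_const continuous_on_id)

lemma trig_poly_bounded: "trig_poly p \<Longrightarrow> \<exists>C\<ge>0. \<forall>x. \<bar>p x\<bar> \<le> C"
proof (induction rule: trig_poly.induct)
  case (scale p c)
  then obtain C where "C \<ge> 0" "\<And>x. \<bar>p x\<bar> \<le> C" by auto
  then show ?case
    by (intro exI[of _ "\<bar>c\<bar> * C"]) (auto simp: abs_mult intro: mult_left_mono)
next
  case (add p q)
  then obtain C D where "C \<ge> 0" "\<And>x. \<bar>p x\<bar> \<le> C" "D \<ge> 0" "\<And>x. \<bar>q x\<bar> \<le> D" by auto
  then show ?case
    by (intro exI[of _ "C + D"]) (auto intro: order_trans[OF abs_triangle_ineq add_mono])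
qed (auto intro!: exI[of _ 1])

text \<open>Rescaling \<open>x - y\<close> makes the two phases differ by exactly 1. If both cosine
  and sine agreed, the addition formula would give cos 1 = 1.\<close>

lemma trig_poly_separates:
  fixes x y :: "'a::real_inner"
  assumes "x \<noteq> y"
  shows "\<exists>p. trig_poly p \<and> p x \<noteq> p y"
proof -
  define u where "u = (1 / ((x - y) \<bullet> (x - y))) *\<^sub>R (x - y)"
  have d: "u \<bullet> x = u \<bullet> y + 1"
  proof -
    have "u \<bullet> (x - y) = 1" using assms by (simp add: u_def)
    then show ?thesis by (simp add: inner_diff_right)
  qed
  show ?thesis
  proof (rule ccontr)
    assume "\<not> ?thesis"
    then have eq: "cos (u \<bullet> x) = cos (u \<bullet> y)" "sin (u \<bullet> x) = sin (u \<bullet> y)"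
      using trig_poly.cos trig_poly.sin by blast+
    have "cos 1 = cos (u \<bullet> x - u \<bullet> y)" by (simp add: d)
    also have "\<dots> = (cos (u \<bullet> y))\<^sup>2 + (sin (u \<bullet> y))\<^sup>2"
      by (simp only: cos_diff eq power2_eq_square)
    also have "\<dots> = 1" by simp
    finally have "cos (1::real) = 1" .
    moreover have "cos (1::real) < cos 0"
      by (rule cos_monotone_0_pi) (use pi_gt3 in auto)
    ultimately show False by simp
  qed
qed

lemma trig_poly_compose_polynomial:
  assumes "real_polynomial_function q" "trig_poly p"
  shows "trig_poly (\<lambda>x. q (p x))"
  using assms(1)
proof (induction rule: real_polynomial_function.induct)
  case (linear q)
  then obtain c where "q = (\<lambda>t. c * t)"
    by (auto simp: real_bounded_linear mult.commute)
  then show ?case using assms(2) by (simp add: trig_poly.scale)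
qed (simp_all add: trig_poly_const trig_poly.add trig_poly_mult)

text \<open>The uniform closure of the trigonometric polynomials is stable under truncation, which keeps
  the approximation bounded off the compact set.\<close>

lemma trig_poly_approximation:
  fixes g :: "'a::euclidean_space \<Rightarrow> real"
  assumes "compact S" "continuous_on S g" "\<And>x. \<bar>g x\<bar> \<le> B" "0 < e"
  obtains p where "trig_poly p" "\<And>x. x \<in> S \<Longrightarrow> \<bar>g x - p x\<bar> < e" "\<And>x. \<bar>p x\<bar> \<le> B + e"
proof -
  have "\<exists>p. trig_poly p \<and> (\<forall>x\<in>S. \<bar>g x - p x\<bar> < e/2)"
    by (rule Stone_Weierstrass_HOL[OF assms(1)])
      (use assms in \<open>simp_all add: trig_poly_const trig_poly_continuous trig_poly.add trig_poly_mult trig_poly_separates\<close>)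
  then obtain p where p: "trig_poly p" "\<And>x. x \<in> S \<Longrightarrow> \<bar>g x - p x\<bar> < e/2" by auto
  obtain C where C: "\<And>x. \<bar>p x\<bar> \<le> C" using trig_poly_bounded[OF p(1)] by auto
  \<comment> \<open>As \<open>g\<close> takes values in [-B, B], clamping \<open>p\<close> to that
    interval does not move it away from \<open>g\<close>. The polynomial \<open>q\<close> imitates
    the clamp on [-C, C], which contains the range of \<open>p\<close> on the whole space.\<close>
  have "continuous_on {-C..C} (\<lambda>t. max (-B) (min B t))" by (intro continuous_intros)
  then obtain q where q: "real_polynomial_function q"
      "\<And>t. t \<in> {-C..C} \<Longrightarrow> \<bar>max (-B) (min B t) - q t\<bar> < e/2"
    using Stone_Weierstrass_real_polynomial_function[of "{-C..C}" "\<lambda>t. max (-B) (min B t)" "e/2"] assms(4)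
    by auto
  have q': "\<bar>max (-B) (min B (p x)) - q (p x)\<bar> < e/2" for x
    using q(2)[of "p x"] C[of x] by (auto simp: abs_le_iff)
  show thesis
  proof
    show "trig_poly (\<lambda>x. q (p x))" by (rule trig_poly_compose_polynomial[OF q(1) p(1)])
    show "\<bar>g x - q (p x)\<bar> < e" if "x \<in> S" for x
      using q'[of x] p(2)[OF that] assms(3)[of x] by linarith
    show "\<bar>q (p x)\<bar> \<le> B + e" for x
      using q'[of x] assms(3)[of x] assms(4) by linarith
  qed
qed

text \<open>Linearity extends convergence from the generators to their span. Being a probability
  measure is asked only for large \<open>n\<close>, because the estimators are measurable only from
  some sample size on.\<close>

lemma integral_trig_poly_tendsto:
  fixes L :: "nat \<Rightarrow> ('a::euclidean_space) measure"
  assumes "eventually (\<lambda>n. prob_space (L n) \<and> sets (L n) = sets borel) sequentially"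
    and "prob_space N" "sets N = sets borel"
    and "\<And>u. (\<lambda>n. \<integral>x. cos (u \<bullet> x) \<partial>L n) \<longlonglongrightarrow> (\<integral>x. cos (u \<bullet> x) \<partial>N)"
    and "\<And>u. (\<lambda>n. \<integral>x. sin (u \<bullet> x) \<partial>L n) \<longlonglongrightarrow> (\<integral>x. sin (u \<bullet> x) \<partial>N)"
    and "trig_poly p"
  shows "(\<lambda>n. \<integral>x. p x \<partial>L n) \<longlonglongrightarrow> (\<integral>x. p x \<partial>N)"
  using assms(6)
proof (induction rule: trig_poly.induct)
  case (scale p c)
  then show ?case by (simp add: tendsto_mult_left)
next
  case (add p q)
  have int: "integrable M r" if M: "prob_space M" "sets M = sets borel" and r: "trig_poly r"
    for M :: "'a measure" and r
  proof -
    interpret prob_space M by fact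
    obtain C where "\<And>x. \<bar>r x\<bar> \<le> C" using trig_poly_bounded[OF r] by auto
    then show ?thesis
      using M borel_measurable_continuous_onI[OF trig_poly_continuous[OF r]]
      by (intro integrable_const_bound[of _ C]) (auto simp: measurable_cong_sets[OF M(2) refl])
  qed
  have "(\<lambda>n. (\<integral>x. p x \<partial>L n) + (\<integral>x. q x \<partial>L n)) \<longlonglongrightarrow> (\<integral>x. p x \<partial>N) + (\<integral>x. q x \<partial>N)"
    using add by (intro tendsto_intros)
  moreover have "\<forall>\<^sub>F n in sequentially.
      (\<integral>x. p x \<partial>L n) + (\<integral>x. q x \<partial>L n) = (\<integral>x. p x + q x \<partial>L n)"
    using assms(1)
  proof eventually_elim
    case (elim n)
    show ?case by (rule Bochner_Integration.integral_add[symmetric]) (use elim int add.hyps in auto)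
  qed
  ultimately have "(\<lambda>n. \<integral>x. p x + q x \<partial>L n) \<longlonglongrightarrow> (\<integral>x. p x \<partial>N) + (\<integral>x. q x \<partial>N)"
    by (rule Lim_transform_eventually)
  also have "(\<integral>x. p x \<partial>N) + (\<integral>x. q x \<partial>N) = (\<integral>x. p x + q x \<partial>N)"
    by (rule Bochner_Integration.integral_add[symmetric]) (use assms int add.hyps in auto)
  finally show ?case .
qed (use assms in auto)

text \<open>On \<open>S\<close> the integrands differ by at most \<open>e\<close>; off
  \<open>S\<close> the sum of their bounds, \<open>2 * B + e\<close>, is used.\<close>

lemma (in prob_space) integral_diff_le_tight:
  assumes [measurable]: "p \<in> borel_measurable M" "g \<in> borel_measurable M" "S \<in> sets M"
    and g: "\<And>x. \<bar>g x\<bar> \<le> B" and p: "\<And>x. \<bar>p x\<bar> \<le> B + e"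
    and gp: "\<And>x. x \<in> S \<Longrightarrow> \<bar>g x - p x\<bar> \<le> e" and e: "0 \<le> e"
  shows "\<bar>(\<integral>x. g x \<partial>M) - (\<integral>x. p x \<partial>M)\<bar> \<le> e + (2 * B + e) * prob (space M - S)"
proof -
  have ig: "integrable M g" by (rule integrable_const_bound[of _ B]) (use g in auto)
  have ip: "integrable M p" by (rule integrable_const_bound[of _ "B + e"]) (use p in auto)
  have B: "0 \<le> B" using g[of undefined] by linarith
  have "\<bar>(\<integral>x. g x \<partial>M) - (\<integral>x. p x \<partial>M)\<bar> = \<bar>\<integral>x. g x - p x \<partial>M\<bar>" using ig ip by simp
  also have "\<dots> \<le> (\<integral>x. \<bar>g x - p x\<bar> \<partial>M)" by (rule integral_abs_bound)
  also have "\<dots> \<le> (\<integral>x. e + (2 * B + e) * indicator (space M - S) x \<partial>M)"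
  proof (rule integral_mono)
    show "\<bar>g x - p x\<bar> \<le> e + (2 * B + e) * indicator (space M - S) x" if "x \<in> space M" for x
      using that gp[of x] g[of x] p[of x] e by (auto split: split_indicator)
    show "integrable M (\<lambda>x. e + (2 * B + e) * indicator (space M - S) x)"
      by (intro Bochner_Integration.integrable_add integrable_const integrable_mult_right
          integrable_real_indicator) (auto simp: less_top[symmetric])
  qed (use ig ip in auto)
  also have "\<dots> = e + (2 * B + e) * prob (space M - S)"
    by (subst Bochner_Integration.integral_add)
      (auto simp: prob_space less_top[symmetric] intro!: integrable_real_indicator)
  finally show ?thesis .
qed

text \<open>The approximation by a trigonometric polynomial is uniform only on a ball. Outside it
  both functions are bounded and the mass is small: under \<open>L n\<close> by
  \<open>tight\<close>, under \<open>N\<close> because a single law is tight.\<close>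

theorem levy_continuity_euclidean:
  fixes L :: "nat \<Rightarrow> ('a::euclidean_space) measure"
  assumes L: "eventually (\<lambda>n. prob_space (L n) \<and> sets (L n) = sets borel) sequentially"
    and N: "prob_space N" "sets N = sets borel"
    and cos: "\<And>u. (\<lambda>n. \<integral>x. cos (u \<bullet> x) \<partial>L n) \<longlonglongrightarrow> (\<integral>x. cos (u \<bullet> x) \<partial>N)"
    and sin: "\<And>u. (\<lambda>n. \<integral>x. sin (u \<bullet> x) \<partial>L n) \<longlonglongrightarrow> (\<integral>x. sin (u \<bullet> x) \<partial>N)"
    and tight: "\<And>e. 0 < e \<Longrightarrow> \<exists>R. eventually (\<lambda>n. measure (L n) (UNIV - cball 0 R) < e) sequentially"
  shows "converges_weakly L N"
  unfolding converges_weakly_def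
proof safe
  fix g :: "'a \<Rightarrow> real"
  assume cont: "continuous_on UNIV g" and bdd: "bounded (range g)"
  obtain B0 where "\<And>x. \<bar>g x\<bar> \<le> B0" using bdd by (auto simp: bounded_iff)
  then obtain B where B: "B > 0" "\<And>x. \<bar>g x\<bar> \<le> B"
    by (metis abs_ge_zero add_pos_nonneg less_add_one order.strict_trans1 order.trans less_imp_le)
  interpret N: prob_space N by fact
  have g[measurable]: "g \<in> borel_measurable borel" by (rule borel_measurable_continuous_onI[OF cont])
  show "(\<lambda>n. \<integral>y. g y \<partial>L n) \<longlonglongrightarrow> (\<integral>y. g y \<partial>N)"
  proof (rule tendstoI)
    fix \<eta> :: real assume "0 < \<eta>"
    \<comment> \<open>Chosen so that \<open>e + (2 * B + 1) * e\<close> is at most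
      \<open>\<eta> / 6\<close>; the cap 1 allows \<open>2 * B + e\<close> to be replaced by
      \<open>2 * B + 1\<close>. Three errors of this size then stay below
      \<open>\<eta>\<close>.\<close>
    define e where "e = min 1 (\<eta> / 6 / (1 + (2 * B + 1)))"
    have e: "0 < e" "e \<le> 1" using \<open>0 < \<eta>\<close> \<open>0 < B\<close> by (auto simp: e_def)
    have "e \<le> \<eta> / 6 / (1 + (2 * B + 1))" by (simp add: e_def)
    then have e3: "e * (1 + (2 * B + 1)) \<le> \<eta> / 6"
      using \<open>0 < B\<close> by (subst (asm) pos_le_divide_eq) auto
    obtain R where R: "eventually (\<lambda>n. measure (L n) (UNIV - cball 0 R) < e) sequentially"
      using tight e by blast
    have "(\<lambda>i. N.prob (UNIV - cball 0 (real i))) \<longlonglongrightarrow> N.prob (\<Inter>i. UNIV - cball 0 (real i))"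
      by (rule N.finite_Lim_measure_decseq) (auto simp: decseq_def N)
    moreover have "(\<Inter>i. UNIV - cball (0::'a) (real i)) = {}"
      by (auto simp: not_le) (meson real_arch_simple not_le)
    ultimately have "(\<lambda>i. N.prob (UNIV - cball 0 (real i))) \<longlonglongrightarrow> 0"
      by (simp only: measure_empty)
    then have "eventually (\<lambda>i. N.prob (UNIV - cball 0 (real i)) < e) sequentially"
      using e(1) by (rule order_tendstoD)
    then obtain i where i: "N.prob (UNIV - cball 0 (real i)) < e"
      by (auto simp: eventually_sequentially)
    define S where "S = cball (0::'a) (max R (real i))"
    obtain p where p: "trig_poly p" "\<And>x. x \<in> S \<Longrightarrow> \<bar>g x - p x\<bar> < e" "\<And>x. \<bar>p x\<bar> \<le> B + e"
      using trig_poly_approximation[of S g B e] continuous_on_subset[OF cont] B e(1)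
      unfolding S_def by auto
    have p_meas[measurable]: "p \<in> borel_measurable borel"
      by (rule borel_measurable_continuous_onI[OF trig_poly_continuous[OF p(1)]])
    have close: "\<bar>(\<integral>x. g x \<partial>M) - (\<integral>x. p x \<partial>M)\<bar> \<le> \<eta> / 6"
      if M: "prob_space M" "sets M = sets borel" "measure M (UNIV - cball 0 r) < e" "r \<le> max R (real i)"
      for M :: "'a measure" and r
    proof -
      interpret prob_space M by fact
      have sp: "space M = UNIV" using sets_eq_imp_space_eq[OF M(2)] by simp
      have "\<bar>(\<integral>x. g x \<partial>M) - (\<integral>x. p x \<partial>M)\<bar> \<le> e + (2 * B + e) * prob (space M - S)"
        by (rule integral_diff_le_tight)
          (use M B p e in \<open>auto simp: S_def less_imp_le cong: measurable_cong_sets\<close>)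
      also have "prob (space M - S) \<le> prob (UNIV - cball 0 r)"
        using M sp by (intro finite_measure_mono) (auto simp: S_def)
      then have "prob (space M - S) \<le> e" using M(3) by linarith
      then have "(2 * B + e) * prob (space M - S) \<le> (2 * B + 1) * e"
        using B e by (intro mult_mono) auto
      also have "e + (2 * B + 1) * e \<le> \<eta> / 6" using e3 by (simp add: algebra_simps)
      finally show ?thesis by simp
    qed
    have "eventually (\<lambda>n. dist (\<integral>x. p x \<partial>L n) (\<integral>x. p x \<partial>N) < \<eta> / 6) sequentially"
      by (rule tendstoD[OF integral_trig_poly_tendsto[OF L N cos sin p(1)]]) (use \<open>0 < \<eta>\<close> in simp)
    with R L show "\<forall>\<^sub>F n in sequentially. dist (\<integral>y. g y \<partial>L n) (\<integral>y. g y \<partial>N) < \<eta>"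
    proof eventually_elim
      case (elim n)
      then have "\<bar>(\<integral>x. g x \<partial>L n) - (\<integral>x. p x \<partial>L n)\<bar> \<le> \<eta> / 6"
        by (intro close) auto
      moreover have "\<bar>(\<integral>x. g x \<partial>N) - (\<integral>x. p x \<partial>N)\<bar> \<le> \<eta> / 6"
        by (rule close) (use N i in auto)
      moreover have "\<bar>(\<integral>x. p x \<partial>L n) - (\<integral>x. p x \<partial>N)\<bar> < \<eta> / 6"
        using elim by (simp add: dist_real_def)
      ultimately show ?case
        unfolding dist_real_def using \<open>0 < \<eta>\<close> by linarith
    qed
  qed
qed

section \<open>Normal laws with given covariance\<close>

text \<open>The family of all coordinates is the identity map, so its joint law is the product of
  its marginals, which is the criterion for independence.\<close>

lemma indep_vars_PiM_coordinates:
  assumes N: "\<And>i. i \<in> I \<Longrightarrow> prob_space (N i)" and "I \<noteq> {}"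
  shows "prob_space.indep_vars (PiM I N) N (\<lambda>i x. x i) I"
proof -
  interpret prob_space "PiM I N" by (rule prob_space_PiM) (rule N)
  have "distr (PiM I N) (PiM I N) (\<lambda>x. \<lambda>i\<in>I. x i) = distr (PiM I N) (PiM I N) (\<lambda>x. x)"
    by (intro distr_cong) (auto simp: space_PiM PiE_def extensional_restrict)
  also have "\<dots> = PiM I (\<lambda>i. distr (PiM I N) (N i) (\<lambda>x. x i))"
    by (simp add: distr_id) (intro PiM_cong; simp add: distr_PiM_component N)
  finally show ?thesis
    using assms by (subst indep_vars_iff_distr_eq_PiM') auto
qed

text \<open>Viewing the law as a scaled standard normal treats the point mass and the genuine
  densities alike in all later computations.\<close>

lemma normal_law_eq_distr:
  assumes "0 \<le> v"
  shows "normal_law 0 v = distr std_normal_distribution borel (\<lambda>x. sqrt v * x)"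
proof (cases "v = 0")
  case True
  interpret real_distribution std_normal_distribution by (rule real_dist_normal_dist)
  show ?thesis using True by (simp add: normal_law_def distr_const)
next
  case False
  then have v: "0 < sqrt v" using assms by simp
  interpret real_distribution std_normal_distribution by (rule real_dist_normal_dist)
  have "distributed std_normal_distribution lborel (\<lambda>x. x) std_normal_density"
    by (auto simp: distributed_def distr_id2)
  then have "distributed std_normal_distribution lborel (\<lambda>x. sqrt v * x) (normal_density 0 (sqrt v))"
    using v by (subst normal_standard_normal_convert[OF v]) simp
  then have "distr std_normal_distribution lborel (\<lambda>x. sqrt v * x) = density lborel (\<lambda>x. ennreal (normal_density 0 (sqrt v) x))"
    by (simp add: distributed_def)
  moreover have "distr std_normal_distribution lborel (\<lambda>x. sqrt v * x) = distr std_normal_distribution borel (\<lambda>x. sqrt v * x)"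
    by (rule distr_cong) auto
  ultimately show ?thesis using False by (simp add: normal_law_def)
qed

lemma real_distribution_normal_law:
  assumes "0 \<le> v"
  shows "real_distribution (normal_law 0 v)"
proof -
  interpret real_distribution std_normal_distribution by (rule real_dist_normal_dist)
  show ?thesis unfolding normal_law_eq_distr[OF assms] by (rule real_distribution_distr) simp
qed

lemma char_normal_law:
  assumes "0 \<le> v"
  shows "char (normal_law 0 v) t = complex_of_real (exp (- (v * t\<^sup>2) / 2))"
proof -
  have "char (normal_law 0 v) t = char std_normal_distribution (sqrt v * t)"
    unfolding normal_law_eq_distr[OF assms] char_def by (subst integral_distr) (auto simp: mult_ac)
  also have "\<dots> = complex_of_real (exp (- (v * t\<^sup>2) / 2))"
    using assms by (simp add: char_std_normal_distribution power_mult_distrib)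
  finally show ?thesis .
qed

text \<open>Comparing characteristic functions also covers vanishing coefficients, where no density
  exists. The infinite product provides as many independent normals as a sum of squares may
  require.\<close>

lemma distr_linear_combination_std_normal:
  fixes c :: "nat \<Rightarrow> real"
  shows "distr (PiM UNIV (\<lambda>_::nat. std_normal_distribution)) borel (\<lambda>x. \<Sum>i<m. c i * x i)
    = normal_law 0 (\<Sum>i<m. (c i)\<^sup>2)" (is "distr ?M _ _ = _")
proof (rule Levy_uniqueness)
  interpret S: real_distribution std_normal_distribution by (rule real_dist_normal_dist)
  interpret prob_space ?M by (rule prob_space_PiM) (rule S.prob_space_axioms)
  have coord [measurable]: "(\<lambda>x. x i) \<in> borel_measurable ?M" for i
    using measurable_component_singleton[of i UNIV "\<lambda>_::nat. std_normal_distribution"] by simp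
  show "real_distribution (distr ?M borel (\<lambda>x. \<Sum>i<m. c i * x i))"
    by (rule real_distribution_distr) simp
  have v: "0 \<le> (\<Sum>i<m. (c i)\<^sup>2)" by (rule sum_nonneg) simp
  show "real_distribution (normal_law 0 (\<Sum>i<m. (c i)\<^sup>2))"
    by (rule real_distribution_normal_law[OF v])
  have "indep_vars (\<lambda>_. std_normal_distribution) (\<lambda>i x. x i) (UNIV :: nat set)"
    by (rule indep_vars_PiM_coordinates) (auto intro: S.prob_space_axioms)
  then have "indep_vars (\<lambda>_. borel) (\<lambda>i x. c i * x i) (UNIV :: nat set)"
    by (rule indep_vars_compose2[where Y="\<lambda>i y. c i * y"]) simp
  then have ind: "indep_vars (\<lambda>_. borel) (\<lambda>i x. c i * x i) {..<m}"
    by (rule indep_vars_subset) simp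
  have one: "char (distr ?M borel (\<lambda>x. c i * x i)) t = complex_of_real (exp (- ((c i)\<^sup>2 * t\<^sup>2) / 2))" for i t
  proof -
    have "char (distr ?M borel (\<lambda>x. c i * x i)) t = (CLINT x|?M. iexp (t * (c i * x i)))"
      unfolding char_def by (subst integral_distr) auto
    also have "\<dots> = (CLINT y|distr ?M std_normal_distribution (\<lambda>x. x i). iexp (t * (c i * y)))"
      by (subst integral_distr) auto
    also have "distr ?M std_normal_distribution (\<lambda>x. x i) = std_normal_distribution"
      by (rule distr_PiM_component) (auto intro: S.prob_space_axioms)
    also have "(CLINT y|std_normal_distribution. iexp (t * (c i * y))) = char std_normal_distribution (t * c i)"
      unfolding char_def by (simp add: mult_ac)
    finally show ?thesis by (simp add: char_std_normal_distribution power_mult_distrib mult_ac)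
  qed
  show "char (distr ?M borel (\<lambda>x. \<Sum>i<m. c i * x i)) = char (normal_law 0 (\<Sum>i<m. (c i)\<^sup>2))"
  proof
    fix t
    have "char (distr ?M borel (\<lambda>x. \<Sum>i<m. c i * x i)) t = (\<Prod>i<m. complex_of_real (exp (- ((c i)\<^sup>2 * t\<^sup>2) / 2)))"
      by (subst char_distr_sum[OF ind]) (simp only: one)
    also have "\<dots> = complex_of_real (exp (\<Sum>i<m. - ((c i)\<^sup>2 * t\<^sup>2) / 2))"
      by (simp add: exp_sum)
    also have "(\<Sum>i<m. - ((c i)\<^sup>2 * t\<^sup>2) / 2) = - ((\<Sum>i<m. (c i)\<^sup>2) * t\<^sup>2) / 2"
      by (simp add: sum_distrib_right sum_divide_distrib sum_negf)
    finally show "char (distr ?M borel (\<lambda>x. \<Sum>i<m. c i * x i)) t = char (normal_law 0 (\<Sum>i<m. (c i)\<^sup>2)) t"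
      by (simp add: char_normal_law[OF v])
  qed
qed

text \<open>Lagrange's reduction: subtracting the square \<open>(T u \<bullet> x)\<^sup>2 / (u \<bullet> T u)\<close> keeps the form
  nonnegative and puts \<open>u\<close> in its kernel.\<close>

lemma psd_form_sum_of_squares:
  fixes T :: "'a::euclidean_space \<Rightarrow> 'a"
  assumes "linear T" "\<And>x y. T x \<bullet> y = x \<bullet> T y" "\<And>x. 0 \<le> x \<bullet> T x"
  shows "\<exists>(m::nat) b. \<forall>x. x \<bullet> T x = (\<Sum>i<m. (x \<bullet> b i)\<^sup>2)"
  using assms
\<comment> \<open>The induction is on the rank of \<open>T\<close>, written as the codimension of
  its kernel.\<close>
proof (induction "DIM('a) - dim {x. T x = 0}" arbitrary: T rule: less_induct)
  case less
  show ?case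
  proof (cases "\<forall>u. u \<bullet> T u = 0")
    case True
    then show ?thesis by (intro exI[of _ 0]) simp
  next
    case False
    then obtain u where u: "u \<bullet> T u > 0" using less.prems(3) by (metis less_eq_real_def)
    define c where "c = T u"
    have uc: "u \<bullet> c > 0" "c \<bullet> u > 0" using u by (simp_all add: c_def inner_commute)
    have cT: "c \<bullet> x = u \<bullet> T x" for x unfolding c_def by (rule less.prems(2))
    define T' where "T' x = T x - ((c \<bullet> x) / (u \<bullet> c)) *\<^sub>R c" for x
    have lin: "linear T'"
      unfolding T'_def
      by (intro linear_compose_sub less.prems(1) linearI)
        (auto simp: inner_add_right add_divide_distrib scaleR_add_left)
    have adj: "T' x \<bullet> y = x \<bullet> T' y" for x y
      using less.prems(2)[of x y]
      by (simp add: T'_def inner_diff_left inner_diff_right inner_commute[of c] mult_ac)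
    have form: "x \<bullet> T' x = x \<bullet> T x - (x \<bullet> c)\<^sup>2 / (u \<bullet> c)" for x
      by (simp add: T'_def inner_diff_right inner_commute power2_eq_square)
    have psd: "0 \<le> x \<bullet> T' x" for x
    proof -
      \<comment> \<open>This \<open>t\<close> minimizes the form of \<open>T\<close> along the line
        \<open>x - t u\<close>, and the minimum is the reduced form at \<open>x\<close>.\<close>
      define t where "t = (x \<bullet> c) / (u \<bullet> c)"
      have Tl: "T (x - t *\<^sub>R u) = T x - t *\<^sub>R c"
        by (simp add: linear_diff[OF less.prems(1)] linear_cmul[OF less.prems(1)] c_def)
      have "0 \<le> (x - t *\<^sub>R u) \<bullet> T (x - t *\<^sub>R u)" by (rule less.prems(3))
      also have "\<dots> = x \<bullet> T x - 2 * t * (x \<bullet> c) + t\<^sup>2 * (u \<bullet> c)"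
        unfolding Tl
        by (simp add: inner_diff_left inner_diff_right cT[symmetric] inner_commute power2_eq_square algebra_simps)
      also have "\<dots> = x \<bullet> T' x"
        unfolding form t_def using uc by (simp add: power2_eq_square field_simps)
      finally show ?thesis .
    qed
    have "{x. T x = 0} \<subset> {x. T' x = 0}"
    proof
      show "{x. T x = 0} \<subseteq> {x. T' x = 0}" by (auto simp: T'_def cT)
      have "u \<in> {x. T' x = 0}" using uc by (simp add: T'_def c_def[symmetric] inner_commute)
      moreover have "u \<notin> {x. T x = 0}" using u by auto
      ultimately show "{x. T x = 0} \<noteq> {x. T' x = 0}" by blast
    qed
    then have "dim {x. T x = 0} < dim {x. T' x = 0}"
      using less.prems(1) lin
      by (intro dim_psubset) (simp add: span_eq_iff[THEN iffD2] linear_subspace_kernel)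
    moreover have "dim {x. T' x = 0} \<le> DIM('a)" by (rule dim_subset_UNIV)
    ultimately have "DIM('a) - dim {x. T' x = 0} < DIM('a) - dim {x. T x = 0}" by linarith
    from less.hyps[OF this lin adj psd] obtain m :: nat and b where b: "\<And>x. x \<bullet> T' x = (\<Sum>i<m. (x \<bullet> b i)\<^sup>2)"
      by blast
    \<comment> \<open>The last vector is scaled so that its square restores the subtracted
      term.\<close>
    define b' where "b' i = (if i < m then b i else (1 / sqrt (u \<bullet> c)) *\<^sub>R c)" for i
    have "x \<bullet> T x = (\<Sum>i<Suc m. (x \<bullet> b' i)\<^sup>2)" for x
    proof -
      have "(\<Sum>i<Suc m. (x \<bullet> b' i)\<^sup>2) = x \<bullet> T' x + (x \<bullet> b' m)\<^sup>2"
        unfolding b sum.lessThan_Suc by (simp add: b'_def)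
      also have "(x \<bullet> b' m)\<^sup>2 = (x \<bullet> c)\<^sup>2 / (u \<bullet> c)"
        using uc by (simp add: b'_def power_divide)
      finally show ?thesis unfolding form by simp
    qed
    then show ?thesis by blast
  qed
qed

text \<open>Writing the form as the sum of \<open>(u \<bullet> b i)\<^sup>2\<close> means that
  \<open>S\<close> is the sum of the rank-one matrices b_i b_i^T. The combination of the
  \<open>b i\<close> with independent standard normal coefficients has this covariance, singular or
  not.\<close>

lemma multivariate_normal_exists:
  fixes S :: "real^'k::finite^'k"
  assumes sym: "transpose S = S" and psd: "\<And>u. 0 \<le> u \<bullet> (S *v u)"
  shows "\<exists>L. multivariate_normal L 0 S"
proof -
  let ?M = "PiM UNIV (\<lambda>_::nat. std_normal_distribution)"
  interpret S: real_distribution std_normal_distribution by (rule real_dist_normal_dist)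
  interpret prob_space ?M by (rule prob_space_PiM) (rule S.prob_space_axioms)
  have coord [measurable]: "(\<lambda>x. x i) \<in> borel_measurable ?M" for i
    using measurable_component_singleton[of i UNIV "\<lambda>_::nat. std_normal_distribution"] by simp
  have "\<exists>(m::nat) b. \<forall>x. x \<bullet> (S *v x) = (\<Sum>i<m. (x \<bullet> b i)\<^sup>2)"
  proof (rule psd_form_sum_of_squares)
    show "(S *v x) \<bullet> y = x \<bullet> (S *v y)" for x y
      by (metis sym adjoint_matrix adjoint_works matrix_vector_mul_linear inner_commute)
  qed (use psd in auto)
  then obtain m :: nat and b where b: "\<And>x. x \<bullet> (S *v x) = (\<Sum>i<m. (x \<bullet> b i)\<^sup>2)" by blast
  define Z where "Z x = (\<Sum>i<m. x i *\<^sub>R b i)" for x :: "nat \<Rightarrow> real"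
  have Z [measurable]: "Z \<in> borel_measurable ?M" unfolding Z_def by measurable
  have "distr (distr ?M borel Z) borel (\<lambda>x. u \<bullet> x) = normal_law (u \<bullet> 0) (u \<bullet> (S *v u))" for u
  proof -
    have "distr (distr ?M borel Z) borel (\<lambda>x. u \<bullet> x) = distr ?M borel (\<lambda>x. u \<bullet> Z x)"
      by (subst distr_distr) (auto simp: comp_def)
    also have "\<dots> = distr ?M borel (\<lambda>x. \<Sum>i<m. (u \<bullet> b i) * x i)"
      by (simp add: Z_def inner_sum_right mult.commute)
    also have "\<dots> = normal_law 0 (\<Sum>i<m. (u \<bullet> b i)\<^sup>2)"
      by (rule distr_linear_combination_std_normal)
    finally show ?thesis by (simp add: b)
  qed
  then have "multivariate_normal (distr ?M borel Z) 0 S"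
    unfolding multivariate_normal_def using sym psd by (auto intro: prob_space_distr)
  then show ?thesis by blast
qed

lemma multivariate_normal_trig:
  assumes "multivariate_normal L 0 S"
  shows "(CLINT x|L. iexp (u \<bullet> x)) = complex_of_real (exp (- (u \<bullet> (S *v u)) / 2))"
proof -
  have L: "prob_space L" "sets L = sets borel" "0 \<le> u \<bullet> (S *v u)"
      "distr L borel (\<lambda>x. u \<bullet> x) = normal_law 0 (u \<bullet> (S *v u))"
    using assms unfolding multivariate_normal_def by auto
  have [measurable]: "(\<lambda>x. u \<bullet> x) \<in> borel_measurable L"
    unfolding measurable_cong_sets[OF L(2) refl] by measurable
  have "(CLINT x|L. iexp (u \<bullet> x)) = char (distr L borel (\<lambda>x. u \<bullet> x)) 1"
    unfolding char_def by (subst integral_distr) auto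
  then show ?thesis unfolding L(4) by (simp add: char_normal_law[OF L(3)])
qed

section \<open>Sums of independent observations\<close>

text \<open>Samples of different sizes live on different spaces, whereas the central limit theorem
  speaks of one sequence on one space. \<open>stream\<close> is that space, and
  \<open>sample n\<close> is its image under restriction to the first \<open>n\<close>
  coordinates.\<close>

locale iid_sample = prob_space \<mu> for \<mu> :: "'a measure"
begin

abbreviation sample :: "nat \<Rightarrow> (nat \<Rightarrow> 'a) measure" where
  "sample n \<equiv> PiM {..<n} (\<lambda>_. \<mu>)"

abbreviation stream :: "(nat \<Rightarrow> 'a) measure" where
  "stream \<equiv> PiM UNIV (\<lambda>_. \<mu>)"

sublocale S: product_prob_space "\<lambda>_::nat. \<mu>" UNIV
  by unfold_locales

lemma distr_restrict_sample: "distr stream (sample n) (\<lambda>x. restrict x {..<n}) = sample n"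
  by (rule S.distr_PiM_restrict_finite) auto

lemma integral_sample:
  fixes F :: "(nat \<Rightarrow> 'a) \<Rightarrow> 'b::{banach, second_countable_topology}"
  assumes "F \<in> borel_measurable (sample n)"
  shows "(\<integral>x. F x \<partial>sample n) = (\<integral>x. F (restrict x {..<n}) \<partial>stream)"
proof -
  have "(\<integral>x. F x \<partial>sample n) = (\<integral>x. F x \<partial>distr stream (sample n) (\<lambda>x. restrict x {..<n}))"
    by (simp add: distr_restrict_sample)
  also have "\<dots> = (\<integral>x. F (restrict x {..<n}) \<partial>stream)"
    by (rule integral_distr) (use assms in \<open>auto intro: measurable_restrict_subset\<close>)
  finally show ?thesis .
qed

lemma coordinate_stream:
  assumes [measurable]: "g \<in> borel_measurable \<mu>"
  shows "(\<lambda>x. g (x i)) \<in> borel_measurable stream" by measurable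

lemma coordinate_sample:
  assumes [measurable]: "g \<in> borel_measurable \<mu>" and i: "i < n"
  shows "(\<lambda>x. g (x i)) \<in> borel_measurable (sample n)"
proof -
  have "(\<lambda>x. x i) \<in> measurable (sample n) \<mu>"
    by (rule measurable_component_singleton) (use i in simp)
  then show ?thesis by (rule measurable_compose) (rule assms(1))
qed

lemma sum_sample:
  fixes g :: "'a \<Rightarrow> 'b::{second_countable_topology, real_normed_vector}"
  assumes "g \<in> borel_measurable \<mu>"
  shows "(\<lambda>x. \<Sum>k<n. g (x k)) \<in> borel_measurable (sample n)"
  by (rule borel_measurable_sum) (use coordinate_sample[OF assms] in auto)

lemma AE_sample:
  assumes "AE y in \<mu>. Q y"
  shows "AE x in sample n. \<forall>k\<in>{..<n}. Q (x k)"
proof (rule AE_finite_allI)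
  fix k assume "k \<in> {..<n}"
  then show "AE x in sample n. Q (x k)"
    using AE_PiM_component[where I="{..<n}" and M="\<lambda>_. \<mu>" and i=k and P=Q] assms prob_space_axioms
    by simp
qed simp

lemma distr_coordinate: "distr stream \<mu> (\<lambda>x. x i) = \<mu>"
  by (rule distr_PiM_component) (auto intro: prob_space_axioms)

lemma integral_coordinate:
  fixes g :: "'a \<Rightarrow> 'b::{banach, second_countable_topology}"
  assumes "g \<in> borel_measurable \<mu>"
  shows "(\<integral>x. g (x i) \<partial>stream) = (\<integral>y. g y \<partial>\<mu>)"
proof -
  have "(\<integral>x. g (x i) \<partial>stream) = (\<integral>y. g y \<partial>distr stream \<mu> (\<lambda>x. x i))"
    by (subst integral_distr) (use assms in auto)
  then show ?thesis by (simp only: distr_coordinate)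
qed

lemma integrable_coordinate:
  fixes g :: "'a \<Rightarrow> 'b::{banach, second_countable_topology}"
  assumes "integrable \<mu> g"
  shows "integrable stream (\<lambda>x. g (x i))"
proof -
  have "integrable (distr stream \<mu> (\<lambda>x. x i)) g" by (simp only: distr_coordinate assms)
  then show ?thesis by (subst (asm) integrable_distr_eq) (use assms in auto)
qed

lemma indep_vars_coordinates:
  assumes "g \<in> borel_measurable \<mu>"
  shows "S.indep_vars (\<lambda>_. borel) (\<lambda>i x. g (x i)) UNIV"
proof -
  have "S.indep_vars (\<lambda>_. \<mu>) (\<lambda>i x. x i) UNIV"
    by (rule indep_vars_PiM_coordinates) (auto intro: prob_space_axioms)
  then show ?thesis by (rule S.indep_vars_compose2) (rule assms)
qed

lemma integral_mult_coordinates: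
  fixes g :: "'a \<Rightarrow> real"
  assumes g: "integrable \<mu> g" and mean: "expectation g = 0" and ij: "i \<noteq> j"
  shows "integrable stream (\<lambda>x. g (x i) * g (x j))" "(\<integral>x. g (x i) * g (x j) \<partial>stream) = 0"
proof -
  have gm: "g \<in> borel_measurable \<mu>" using g by auto
  have ind: "S.indep_vars (\<lambda>_. borel) (\<lambda>i x. g (x i)) {i, j}"
    by (rule S.indep_vars_subset[OF indep_vars_coordinates[OF gm]]) simp
  show "integrable stream (\<lambda>x. g (x i) * g (x j))"
    using S.indep_vars_integrable[OF _ ind] integrable_coordinate[OF g] ij by simp
  show "(\<integral>x. g (x i) * g (x j) \<partial>stream) = 0"
    using S.indep_vars_lebesgue_integral[OF _ ind] integrable_coordinate[OF g] ij
    by (simp add: integral_coordinate[OF gm] mean)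
qed

text \<open>Independence and zero mean remove the off-diagonal terms of the expanded square; the
  \<open>n\<close> diagonal terms remain.\<close>

lemma second_moment_sum:
  fixes g :: "'a \<Rightarrow> real"
  assumes [measurable]: "g \<in> borel_measurable \<mu>"
    and sq: "integrable \<mu> (\<lambda>y. (g y)\<^sup>2)" and mean: "expectation g = 0"
  shows "integrable stream (\<lambda>x. (\<Sum>k<n. g (x k))\<^sup>2)"
    "(\<integral>x. (\<Sum>k<n. g (x k))\<^sup>2 \<partial>stream) = real n * expectation (\<lambda>y. (g y)\<^sup>2)"
proof -
  have g: "integrable \<mu> g" by (rule square_integrable_imp_integrable[OF _ sq]) simp
  have int: "integrable stream (\<lambda>x. g (x i) * g (x j))" for i j
    using integral_mult_coordinates(1)[OF g mean, of i j] integrable_coordinate[OF sq, of i]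
    by (cases "i = j") (auto simp: power2_eq_square)
  have val: "(\<integral>x. g (x i) * g (x j) \<partial>stream) = (if i = j then expectation (\<lambda>y. (g y)\<^sup>2) else 0)" for i j
    using integral_mult_coordinates(2)[OF g mean, of i j] integral_coordinate[of "\<lambda>y. (g y)\<^sup>2" i]
    by (auto simp: power2_eq_square)
  show "integrable stream (\<lambda>x. (\<Sum>k<n. g (x k))\<^sup>2)"
    unfolding power2_eq_square sum_product by (intro Bochner_Integration.integrable_sum int)
  have "(\<integral>x. (\<Sum>k<n. g (x k))\<^sup>2 \<partial>stream) = (\<Sum>i<n. \<Sum>j<n. \<integral>x. g (x i) * g (x j) \<partial>stream)"
    unfolding power2_eq_square sum_product
    by (subst Bochner_Integration.integral_sum, (intro Bochner_Integration.integrable_sum int)[1])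
      (intro sum.cong refl Bochner_Integration.integral_sum int)
  also have "\<dots> = real n * expectation (\<lambda>y. (g y)\<^sup>2)"
    unfolding val by (simp add: sum.delta)
  finally show "(\<integral>x. (\<Sum>k<n. g (x k))\<^sup>2 \<partial>stream) = real n * expectation (\<lambda>y. (g y)\<^sup>2)" .
qed

text \<open>The inequality a <= 1 + a^2 turns the second moment, which does not grow with
  \<open>n\<close> after normalization, into a bound on the first moment.\<close>

lemma abs_normalized_sum_le:
  fixes g :: "'a \<Rightarrow> real"
  assumes gm [measurable]: "g \<in> borel_measurable \<mu>"
    and sq: "integrable \<mu> (\<lambda>y. (g y)\<^sup>2)" and mean: "expectation g = 0"
  shows "integrable (sample n) (\<lambda>x. \<bar>(\<Sum>k<n. g (x k)) / sqrt (real n)\<bar>)"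
    "(\<integral>x. \<bar>(\<Sum>k<n. g (x k)) / sqrt (real n)\<bar> \<partial>sample n) \<le> 1 + expectation (\<lambda>y. (g y)\<^sup>2)"
proof -
  let ?F = "\<lambda>x. \<bar>(\<Sum>k<n. g (x k)) / sqrt (real n)\<bar>"
  have Fm [measurable]: "?F \<in> borel_measurable (sample n)"
    by (intro borel_measurable_abs borel_measurable_divide sum_sample gm) simp
  have F_le: "?F x \<le> 1 + (\<Sum>k<n. g (x k))\<^sup>2 / real n" for x
  proof -
    have "?F x \<le> 1 + (?F x)\<^sup>2"
      using sum_power2_ge_zero[of "?F x - 1/2" 0] by (simp add: power2_eq_square algebra_simps)
    then show ?thesis by (simp add: power_divide)
  qed
  have int: "integrable stream (\<lambda>x. 1 + (\<Sum>k<n. g (x k))\<^sup>2 / real n)"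
    using second_moment_sum(1)[OF gm sq mean] by (intro Bochner_Integration.integrable_add integrable_divide) auto
  have res: "?F (restrict x {..<n}) = ?F x" for x by simp
  have intF: "integrable stream ?F"
    by (rule Bochner_Integration.integrable_bound[OF int])
      (use F_le in \<open>auto intro!: AE_I2 intro: order_trans[OF _ abs_ge_self] simp del: abs_divide\<close>)
  have "integrable (distr stream (sample n) (\<lambda>x. restrict x {..<n})) ?F"
    using intF by (subst integrable_distr_eq) (auto intro!: measurable_restrict_subset simp: res)
  then show "integrable (sample n) ?F" by (simp only: distr_restrict_sample)
  have "(\<integral>x. ?F x \<partial>sample n) = (\<integral>x. ?F x \<partial>stream)"
    by (subst integral_sample[OF Fm]) (simp only: res)
  also have "\<dots> \<le> (\<integral>x. 1 + (\<Sum>k<n. g (x k))\<^sup>2 / real n \<partial>stream)"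
    by (rule integral_mono[OF intF int F_le])
  also have "\<dots> = 1 + (real n * expectation (\<lambda>y. (g y)\<^sup>2)) / real n"
    using second_moment_sum[OF gm sq mean, of n] prob_space.prob_space[OF prob_space_PiM, of UNIV "\<lambda>_. \<mu>"]
    by (simp add: prob_space_axioms)
  \<comment> \<open>Equality for positive \<open>n\<close>; for \<open>n = 0\<close> the quotient is
    0 by convention.\<close>
  also have "\<dots> \<le> 1 + expectation (\<lambda>y. (g y)\<^sup>2)" by simp
  finally show "(\<integral>x. ?F x \<partial>sample n) \<le> 1 + expectation (\<lambda>y. (g y)\<^sup>2)" .
qed

lemma char_normalized_sum_tendsto:
  fixes g :: "'a \<Rightarrow> real"
  assumes gm [measurable]: "g \<in> borel_measurable \<mu>"
    and sq: "integrable \<mu> (\<lambda>y. (g y)\<^sup>2)" and mean: "expectation g = 0"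
    and pos: "0 < expectation (\<lambda>y. (g y)\<^sup>2)"
  shows "(\<lambda>n. CLINT x|sample n. iexp ((\<Sum>k<n. g (x k)) / sqrt (real n)))
    \<longlonglongrightarrow> complex_of_real (exp (- expectation (\<lambda>y. (g y)\<^sup>2) / 2))"
proof -
  define \<sigma> where "\<sigma> = sqrt (expectation (\<lambda>y. (g y)\<^sup>2))"
  have \<sigma>: "0 < \<sigma>" "\<sigma>\<^sup>2 = expectation (\<lambda>y. (g y)\<^sup>2)" using pos by (simp_all add: \<sigma>_def)
  have [measurable]: "(\<lambda>x. \<Sum>k<n. g (x k)) \<in> borel_measurable stream" for n
    by (intro borel_measurable_sum coordinate_stream gm)
  let ?D = "\<lambda>n. distr stream borel (\<lambda>x. (\<Sum>k<n. g (x k)) / sqrt (real n * \<sigma>\<^sup>2))"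
  have "weak_conv_m ?D std_normal_distribution"
  proof (rule S.central_limit_theorem_zero_mean[OF indep_vars_coordinates[OF gm]])
    show "(\<integral>x. g (x n) \<partial>stream) = 0" for n using integral_coordinate[OF gm] mean by simp
    show "0 < \<sigma>" by (rule \<sigma>)
    show "integrable stream (\<lambda>x. (g (x n))\<^sup>2)" for n by (rule integrable_coordinate[OF sq])
    show "S.variance (\<lambda>x. g (x n)) = \<sigma>\<^sup>2" for n
      using integral_coordinate[of "\<lambda>y. (g y)\<^sup>2" n] by (simp add: integral_coordinate[OF gm] mean \<sigma>)
    have "distr stream borel (\<lambda>x. g (x n)) = distr (distr stream \<mu> (\<lambda>x. x n)) borel g" for n
      by (subst distr_distr) (auto simp: comp_def)
    then show "distr stream borel (\<lambda>x. g (x n)) = distr \<mu> borel g" for n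
      by (simp only: distr_coordinate)
  qed
  \<comment> \<open>Evaluating at \<open>\<sigma>\<close> instead of 1 undoes the normalization to
    unit variance.\<close>
  then have "(\<lambda>n. char (?D n) \<sigma>) \<longlonglongrightarrow> char std_normal_distribution \<sigma>"
    by (intro levy_continuity1 real_dist_normal_dist S.real_distribution_distr) simp_all
  moreover have "char (?D n) \<sigma> = (CLINT x|sample n. iexp ((\<Sum>k<n. g (x k)) / sqrt (real n)))" for n
  proof -
    have "char (?D n) \<sigma> = (CLINT x|stream. iexp ((\<Sum>k<n. g (x k)) / sqrt (real n)))"
      unfolding char_def using \<sigma>(1) by (subst integral_distr) (auto simp: real_sqrt_mult)
    also have "\<dots> = (CLINT x|sample n. iexp ((\<Sum>k<n. g (x k)) / sqrt (real n)))"
      by (subst integral_sample) (auto intro!: sum_sample gm borel_measurable_divide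
        measurable_compose[of _ _ _ iexp] borel_measurable_continuous_onI continuous_intros)
    finally show ?thesis .
  qed
  ultimately show ?thesis
    by (simp add: char_std_normal_distribution \<sigma>)
qed

end

section \<open>Estimates from bounds on partial derivatives\<close>

text \<open>Mean value theorem along the path from \<open>w\<close> to \<open>v\<close> that changes one coordinate at a time; it
  stays in every ball around \<open>w\<close> that contains \<open>v\<close>.\<close>

lemma coordinate_path_estimate:
  fixes g :: "real^'i::finite \<Rightarrow> real"
  assumes diff: "\<And>v a. v \<in> cball w \<rho> \<Longrightarrow> has_iter_partial [a] g v"
    and bound: "\<And>v a. v \<in> cball w \<rho> \<Longrightarrow> \<bar>iter_partial [a] g v - c a\<bar> \<le> e"
    and v: "v \<in> cball w \<rho>"
  shows "\<bar>g v - g w - (\<Sum>a\<in>UNIV. c a * (v $ a - w $ a))\<bar> \<le> e * (\<Sum>a\<in>UNIV. \<bar>v $ a - w $ a\<bar>)"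
proof -
  define z where "z S = (\<chi> a. if a \<in> S then v $ a else w $ a)" for S
  have near: "x \<in> cball w \<rho>" if "\<And>a. \<bar>x $ a - w $ a\<bar> \<le> \<bar>v $ a - w $ a\<bar>" for x
  proof -
    have "norm (x - w) \<le> norm (v - w)"
      by (rule norm_le_componentwise_cart) (use that in auto)
    then show ?thesis using v by (simp add: dist_norm norm_minus_commute)
  qed
  have step: "\<bar>g (z (insert a S)) - g (z S) - c a * (v $ a - w $ a)\<bar> \<le> e * \<bar>v $ a - w $ a\<bar>"
    if "a \<notin> S" for a S
  proof -
    define d where "d = v $ a - w $ a"
    \<comment> \<open>Subtracting the linear part makes the derivative of \<open>\<gamma>\<close>
      equal to \<open>d\<close> times the deviation of the partial derivative from
      \<open>c a\<close>, which \<open>e\<close> bounds.\<close>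
    define \<gamma> where "\<gamma> t = g (z S + (t * d) *\<^sub>R axis a 1) - t * (c a * d)" for t :: real
    have in_ball: "z S + (t * d) *\<^sub>R axis a 1 \<in> cball w \<rho>" if "0 \<le> t" "t \<le> 1" for t
    proof (rule near)
      fix b
      show "\<bar>(z S + (t * d) *\<^sub>R axis a 1) $ b - w $ b\<bar> \<le> \<bar>v $ b - w $ b\<bar>"
        using that \<open>a \<notin> S\<close> by (auto simp: z_def d_def axis_def abs_mult mult_left_le_one_le)
    qed
    have deriv: "(\<gamma> has_real_derivative
        (iter_partial [a] g (z S + (t * d) *\<^sub>R axis a 1) - c a) * d) (at t)"
      if "0 \<le> t" "t \<le> 1" for t
    proof -
      let ?y = "z S + (t * d) *\<^sub>R axis a 1"
      have "(\<lambda>u. g (?y + u *\<^sub>R axis a 1)) field_differentiable (at 0)"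
        using diff[OF in_ball[OF that], of a] by simp
      \<comment> \<open>The point 0 is written \<open>(t - t) * d\<close>, the value at
        \<open>t\<close> of the inner map in \<open>s\<close>, to put it in the shape the chain rule
        expects.\<close>
      then have "((\<lambda>u. g (?y + u *\<^sub>R axis a 1)) has_field_derivative iter_partial [a] g ?y) (at ((t - t) * d))"
        by (simp add: field_differentiable_derivI)
      then have "((\<lambda>s. g (?y + ((s - t) * d) *\<^sub>R axis a 1)) has_field_derivative iter_partial [a] g ?y * d) (at t)"
        by (rule DERIV_chain2) (auto intro!: derivative_eq_intros)
      moreover have "?y + ((s - t) * d) *\<^sub>R axis a 1 = z S + (s * d) *\<^sub>R axis a 1" for s
        by (simp add: algebra_simps)
      ultimately have "((\<lambda>s. g (z S + (s * d) *\<^sub>R axis a 1)) has_field_derivative iter_partial [a] g ?y * d) (at t)"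
        by simp
      then show ?thesis
        unfolding \<gamma>_def by (auto intro!: derivative_eq_intros simp: algebra_simps)
    qed
    obtain \<xi> where \<xi>: "0 < \<xi>" "\<xi> < 1"
        "\<gamma> 1 - \<gamma> 0 = (iter_partial [a] g (z S + (\<xi> * d) *\<^sub>R axis a 1) - c a) * d"
      using MVT2[of 0 1 \<gamma> "\<lambda>t. (iter_partial [a] g (z S + (t * d) *\<^sub>R axis a 1) - c a) * d"] deriv
      by auto
    have "z (insert a S) = z S + (1 * d) *\<^sub>R axis a 1" using \<open>a \<notin> S\<close>
      by (auto simp: z_def d_def axis_def vec_eq_iff)
    then have "g (z (insert a S)) - g (z S) - c a * d = \<gamma> 1 - \<gamma> 0" by (simp add: \<gamma>_def)
    then show ?thesis
      using bound[OF in_ball[of \<xi>], of a] \<xi> unfolding d_def[symmetric]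
      by (simp add: abs_mult mult_right_mono)
  qed
  have "\<bar>g (z S) - g w - (\<Sum>a\<in>S. c a * (v $ a - w $ a))\<bar> \<le> e * (\<Sum>a\<in>S. \<bar>v $ a - w $ a\<bar>)"
    if "finite S" for S
    using that
  proof (induction S)
    case empty
    have "z {} = w" by (simp add: z_def vec_eq_iff)
    then show ?case by simp
  next
    case (insert a S)
    then show ?case using step[of a S] by (simp add: distrib_left)
  qed
  from this[of UNIV] show ?thesis by (simp add: z_def)
qed

text \<open>Existence of a derivative includes existence of the next lower one on a neighbourhood
  along the line, in particular at the point itself.\<close>

lemma has_iter_partial_order: "has_iter_partial (i # j # js) g v \<Longrightarrow> has_iter_partial (j # js) g v"
proof -
  assume "has_iter_partial (i # j # js) g v"
  then have "\<forall>\<^sub>F u in nhds (0::real). has_iter_partial (j # js) g (v + u *\<^sub>R axis i 1)"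
    by (simp only: has_iter_partial.simps)
  from eventually_nhds_x_imp_x[OF this] show ?thesis by simp
qed

lemma coordinate_path_lipschitz:
  fixes g :: "real^'i::finite \<Rightarrow> real"
  assumes "\<And>v a. v \<in> cball w \<rho> \<Longrightarrow> has_iter_partial [a] g v"
    and "\<And>v a. v \<in> cball w \<rho> \<Longrightarrow> \<bar>iter_partial [a] g v\<bar> \<le> e"
    and "v \<in> cball w \<rho>"
  shows "\<bar>g v - g w\<bar> \<le> e * (\<Sum>a\<in>UNIV. \<bar>v $ a - w $ a\<bar>)"
  using coordinate_path_estimate[of w \<rho> g "\<lambda>_. 0" e v] assms by simp

lemma has_iter_partial_Cons_iter_partial:
  assumes "has_iter_partial (i # js) g v"
  shows "has_iter_partial [i] (iter_partial js g) v"
  using assms by simp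

lemma iter_partial_Cons: "iter_partial (i # js) g = iter_partial [i] (iter_partial js g)"
  by simp

lemma sum_abs_diff_le: "(\<Sum>a\<in>UNIV. \<bar>v $ a - w $ a\<bar>) \<le> real CARD('i) * norm (v - w)"
  for v w :: "real^'i::finite"
  using sum_bounded_above[of UNIV "\<lambda>a. \<bar>v $ a - w $ a\<bar>" "norm (v - w)"]
    component_le_norm_cart[of "v - w"] by simp

lemma iter_partial_lipschitz:
  fixes g :: "real^'i::finite \<Rightarrow> real"
  assumes diff: "\<And>v a b. v \<in> cball w \<rho> \<Longrightarrow> has_iter_partial [a, b] g v"
    and bound: "\<And>v a b. v \<in> cball w \<rho> \<Longrightarrow> \<bar>iter_partial [a, b] g v\<bar> \<le> e"
    and v: "v \<in> cball w \<rho>"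
  shows "\<bar>iter_partial [b] g v - iter_partial [b] g w\<bar> \<le> e * (real CARD('i) * norm (v - w))"
proof -
  have e: "0 \<le> e" using bound[OF v, of undefined undefined] by linarith
  have "\<bar>iter_partial [b] g v - iter_partial [b] g w\<bar> \<le> e * (\<Sum>a\<in>UNIV. \<bar>v $ a - w $ a\<bar>)"
  proof (rule coordinate_path_lipschitz[OF _ _ v])
    fix y a assume y: "y \<in> cball w \<rho>"
    show "has_iter_partial [a] (iter_partial [b] g) y"
      by (rule has_iter_partial_Cons_iter_partial[OF diff[OF y]])
    show "\<bar>iter_partial [a] (iter_partial [b] g) y\<bar> \<le> e"
      using bound[OF y, of a b] by (simp only: iter_partial_Cons[of a "[b]"])
  qed
  also have "\<dots> \<le> e * (real CARD('i) * norm (v - w))"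
    by (intro mult_left_mono sum_abs_diff_le e)
  finally show ?thesis .
qed

text \<open>The path estimate is applied on the ball of radius \<open>norm (v - w)\<close> only,
  with the gradient at \<open>w\<close> as reference. There the partial derivatives deviate by at
  most a multiple of that radius, which supplies the second factor of the remainder.\<close>

lemma coordinate_path_second_order:
  fixes g :: "real^'i::finite \<Rightarrow> real"
  assumes diff: "\<And>v a b. v \<in> cball w \<rho> \<Longrightarrow> has_iter_partial [a, b] g v"
    and bound: "\<And>v a b. v \<in> cball w \<rho> \<Longrightarrow> \<bar>iter_partial [a, b] g v\<bar> \<le> e"
    and v: "v \<in> cball w \<rho>"
  shows "\<bar>g v - g w - (\<Sum>a\<in>UNIV. iter_partial [a] g w * (v $ a - w $ a))\<bar>
    \<le> e * (real CARD('i) * norm (v - w)) * (real CARD('i) * norm (v - w))"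
proof -
  let ?\<rho> = "norm (v - w)"
  have \<rho>: "cball w ?\<rho> \<subseteq> cball w \<rho>" and v': "v \<in> cball w ?\<rho>"
    using v by (auto simp: dist_norm norm_minus_commute)
  have e: "0 \<le> e" using bound[OF v, of undefined undefined] by linarith
  have lip: "\<bar>iter_partial [b] g u - iter_partial [b] g w\<bar> \<le> e * (real CARD('i) * ?\<rho>)"
    if "u \<in> cball w ?\<rho>" for u b
  proof -
    have "\<bar>iter_partial [b] g u - iter_partial [b] g w\<bar> \<le> e * (real CARD('i) * norm (u - w))"
      by (rule iter_partial_lipschitz[OF diff bound]) (use that \<rho> in blast)+
    also have "\<dots> \<le> e * (real CARD('i) * ?\<rho>)"
      using that e by (intro mult_left_mono) (auto simp: dist_norm norm_minus_commute)
    finally show ?thesis .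
  qed
  have "\<bar>g v - g w - (\<Sum>a\<in>UNIV. iter_partial [a] g w * (v $ a - w $ a))\<bar>
      \<le> e * (real CARD('i) * ?\<rho>) * (\<Sum>a\<in>UNIV. \<bar>v $ a - w $ a\<bar>)"
  proof (rule coordinate_path_estimate[OF _ lip v'])
    fix y a assume "y \<in> cball w ?\<rho>"
    then show "has_iter_partial [a] g y"
      using has_iter_partial_order[OF diff[of y a a]] \<rho> by blast
  qed auto
  also have "\<dots> \<le> e * (real CARD('i) * ?\<rho>) * (real CARD('i) * ?\<rho>)"
    by (intro mult_left_mono sum_abs_diff_le) (use e in auto)
  finally show ?thesis .
qed

section \<open>The score of a single observation\<close>

lemma borel_measurable_vec_lambda:
  fixes h :: "'i::finite \<Rightarrow> 'a \<Rightarrow> real"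
  assumes "\<And>i. h i \<in> borel_measurable M"
  shows "(\<lambda>x. \<chi> i. h i x) \<in> borel_measurable M"
  by (rule borel_measurable_euclidean_space[THEN iffD2])
    (auto simp: Basis_vec_def inner_axis assms)

lemma DERIV_imp_difference_quotient_tendsto:
  fixes \<phi> :: "real \<Rightarrow> real"
  assumes "(\<phi> has_field_derivative D) (at 0)" and c: "c \<longlonglongrightarrow> 0" "\<And>n. c n \<noteq> 0"
  shows "(\<lambda>n. (\<phi> (c n) - \<phi> 0) / c n) \<longlonglongrightarrow> D"
proof -
  have "(\<lambda>h. (\<phi> (0 + h) - \<phi> 0) / h) \<midarrow>0\<rightarrow> D" using assms(1) by (simp only: DERIV_def)
  moreover have "filterlim c (at 0) sequentially" using c by (simp add: filterlim_at)
  ultimately show ?thesis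
    using filterlim_compose[of "\<lambda>h. (\<phi> h - \<phi> 0) / h" "nhds D" "at 0" c sequentially] by simp
qed

lemma has_iter_partial_singleton_DERIV:
  assumes "has_iter_partial [i] g p"
  shows "((\<lambda>u. g (p + u *\<^sub>R axis i 1)) has_field_derivative iter_partial [i] g p) (at 0)"
  using assms by (simp add: field_differentiable_derivI)

lemma prob_space_density_imp_integral:
  assumes [measurable]: "\<phi> \<in> borel_measurable M" and nonneg: "\<And>x. 0 \<le> \<phi> x"
    and "prob_space (density M (\<lambda>x. ennreal (\<phi> x)))"
  shows "integrable M \<phi>" "(\<integral>x. \<phi> x \<partial>M) = 1"
proof -
  interpret prob_space "density M (\<lambda>x. ennreal (\<phi> x))" by fact
  have "(\<integral>\<^sup>+x. ennreal (\<phi> x) \<partial>M) = ennreal 1"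
    using emeasure_space_1 by (simp add: emeasure_density cong: nn_integral_cong)
  then have "has_bochner_integral M \<phi> 1"
    by (intro has_bochner_integral_nn_integral) (auto simp: nonneg)
  then show "integrable M \<phi>" "(\<integral>x. \<phi> x \<partial>M) = 1" by (auto simp: has_bochner_integral_iff)
qed

text \<open>The gradient of \<open>ln f\<close> agrees with a limit of measurable difference quotients outside a null
  set; it need not itself be Borel measurable, and its mean vanishes by differentiation under the
  integral sign. Where \<open>f x p = 0\<close> the partial derivatives of \<open>f\<close> vanish because \<open>f \<ge> 0\<close>.\<close>

lemma measurable_score_exists:
  fixes f :: "real \<Rightarrow> real^'r::finite \<Rightarrow> real"
  assumes cond: "density_conditions f p \<alpha> \<kappa>\<^sub>1" and \<alpha>: "0 < \<alpha>"
  obtains g :: "real \<Rightarrow> real^'r" where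
    "g \<in> borel_measurable borel"
    "AE x in obs_law f p. \<forall>i. has_iter_partial [i] (\<lambda>q. ln (f x q)) p \<and>
        g x $ i = iter_partial [i] (\<lambda>q. ln (f x q)) p"
    "\<forall>i. integrable (obs_law f p) (\<lambda>x. g x $ i)" "\<forall>i. (\<integral>x. g x $ i \<partial>obs_law f p) = 0"
    "\<forall>i j. integrable (obs_law f p) (\<lambda>x. g x $ i * g x $ j)"
    "\<forall>i j. (\<integral>x. g x $ i * g x $ j \<partial>obs_law f p) = fisher f p $ i $ j"
proof -
  have meas: "\<And>q. q \<in> cball p \<alpha> \<Longrightarrow> (\<lambda>x. f x q) \<in> borel_measurable borel"
    and nonneg: "\<And>q x. q \<in> cball p \<alpha> \<Longrightarrow> 0 \<le> f x q"
    and prob: "\<And>q. q \<in> cball p \<alpha> \<Longrightarrow> prob_space (obs_law f q)"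
    and log: "AE x in obs_law f p. \<forall>q\<in>cball p \<alpha>. 0 < f x q \<and>
        (\<forall>js. length js \<le> 3 \<longrightarrow> has_iter_partial js (\<lambda>q. ln (f x q)) q)"
    and fish: "\<And>i j. integrable lborel (\<lambda>x. iter_partial [i] (\<lambda>q. ln (f x q)) p
                                * iter_partial [j] (\<lambda>q. ln (f x q)) p * f x p)"
    using cond unfolding density_conditions_def by blast+
  obtain F\<^sub>1 F\<^sub>2 where F1: "integrable lborel F\<^sub>1"
    and "AE x in lborel. \<forall>q\<in>cball p \<alpha>. \<forall>i j.
           has_iter_partial [i] (f x) q \<and> \<bar>iter_partial [i] (f x) q\<bar> \<le> F\<^sub>1 x \<and>
           has_iter_partial [i, j] (f x) q \<and> \<bar>iter_partial [i, j] (f x) q\<bar> \<le> F\<^sub>2 x"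
    using cond unfolding density_conditions_def by blast
  then have dom: "AE x in lborel. \<forall>q\<in>cball p \<alpha>. \<forall>i.
      has_iter_partial [i] (f x) q \<and> \<bar>iter_partial [i] (f x) q\<bar> \<le> F\<^sub>1 x"
    by (elim AE_mp) (rule AE_I2, blast)
  have p: "p \<in> cball p \<alpha>" using \<alpha> by simp
  have fp [measurable]: "(\<lambda>x. f x p) \<in> borel_measurable borel" by (rule meas[OF p])
  \<comment> \<open>The increments are nonzero and never leave the ball, so every shifted function
    is again a density.\<close>
  define c where "c n = \<alpha> / real (Suc n)" for n
  have c: "c \<longlonglongrightarrow> 0" "\<And>n. 0 < c n" "\<And>n. c n \<le> \<alpha>"
    unfolding c_def using \<alpha> LIMSEQ_inverse_real_of_nat
    by (auto simp: divide_inverse intro!: tendsto_mult_right_zero inverse_le_1_iff[THEN iffD2])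
  have cb: "p + c n *\<^sub>R axis i 1 \<in> cball p \<alpha>" for n i
    using c(2,3)[of n] by (simp add: dist_norm)
  have fc [measurable]: "(\<lambda>x. f x (p + c n *\<^sub>R axis i 1)) \<in> borel_measurable borel" for n i
    by (rule meas[OF cb])
  define g where "g x = (\<chi> i. lim (\<lambda>n. (ln (f x (p + c n *\<^sub>R axis i 1)) - ln (f x p)) / c n))" for x
  have g [measurable]: "g \<in> borel_measurable borel"
    unfolding g_def by (intro borel_measurable_vec_lambda borel_measurable_lim_metric) measurable
  have gi [measurable]: "(\<lambda>x. g x $ i) \<in> borel_measurable borel" for i
    unfolding g_def vec_lambda_beta by (intro borel_measurable_lim_metric) measurable
  have g_eq: "AE x in obs_law f p. \<forall>i. has_iter_partial [i] (\<lambda>q. ln (f x q)) p \<and>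
        g x $ i = iter_partial [i] (\<lambda>q. ln (f x q)) p"
    using log
  proof eventually_elim
    case (elim x)
    show ?case
    proof
      fix i
      have h: "has_iter_partial [i] (\<lambda>q. ln (f x q)) p"
        using elim p by (force simp del: has_iter_partial.simps)
      have "(\<lambda>n. (ln (f x (p + c n *\<^sub>R axis i 1)) - ln (f x (p + 0 *\<^sub>R axis i 1))) / c n)
          \<longlonglongrightarrow> iter_partial [i] (\<lambda>q. ln (f x q)) p"
        by (rule DERIV_imp_difference_quotient_tendsto[OF has_iter_partial_singleton_DERIV[OF h] c(1)])
          (use c(2) less_imp_neq in \<open>metis\<close>)
      then have "g x $ i = iter_partial [i] (\<lambda>q. ln (f x q)) p"
        unfolding g_def vec_lambda_beta by (intro limI) simp
      with h show "has_iter_partial [i] (\<lambda>q. ln (f x q)) p \<and> g x $ i = iter_partial [i] (\<lambda>q. ln (f x q)) p" ..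
    qed
  qed
  then have g_eq_leb: "AE x in lborel. 0 < f x p \<longrightarrow> (\<forall>i. has_iter_partial [i] (\<lambda>q. ln (f x q)) p \<and>
        g x $ i = iter_partial [i] (\<lambda>q. ln (f x q)) p)"
    unfolding obs_law_def by (subst (asm) AE_density) (auto simp: ennreal_less_zero_iff)
  \<comment> \<open>Differentiating the total mass integrates over the whole line, so the identity
    is needed Lebesgue-almost everywhere, zeros of the density included.\<close>
  have fg: "AE x in lborel. \<forall>i. f x p * g x $ i = iter_partial [i] (f x) p"
    using g_eq_leb dom
  proof eventually_elim
    case (elim x)
    show ?case
    proof
      fix i
      have h: "has_iter_partial [i] (f x) p" using elim(2) p by blast
      note D = has_iter_partial_singleton_DERIV[OF h]
      show "f x p * g x $ i = iter_partial [i] (f x) p"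
      proof (cases "0 < f x p")
        case True
        have "((\<lambda>u. ln (f x (p + u *\<^sub>R axis i 1))) has_field_derivative
            (1 / f x (p + 0 *\<^sub>R axis i 1)) * iter_partial [i] (f x) p) (at 0)"
          by (rule DERIV_chain2[OF DERIV_ln_divide D]) (use True in simp)
        moreover have "((\<lambda>u. ln (f x (p + u *\<^sub>R axis i 1))) has_field_derivative g x $ i) (at 0)"
          using has_iter_partial_singleton_DERIV[of i "\<lambda>q. ln (f x q)" p] elim(1) True
          by (simp del: has_iter_partial.simps iter_partial.simps)
        ultimately have "g x $ i = (1 / f x (p + 0 *\<^sub>R axis i 1)) * iter_partial [i] (f x) p"
          using DERIV_unique by blast
        then show ?thesis using True by (simp del: iter_partial.simps)
      next
        case False
        then have z: "f x p = 0" using nonneg[OF p, of x] by simp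
        have "iter_partial [i] (f x) p = 0"
        proof (rule DERIV_local_min[OF D \<alpha>], intro allI impI)
          fix u :: real assume "\<bar>0 - u\<bar> < \<alpha>"
          then show "f x (p + 0 *\<^sub>R axis i 1) \<le> f x (p + u *\<^sub>R axis i 1)"
            using nonneg[of "p + u *\<^sub>R axis i 1" x] z by (simp add: dist_norm)
        qed
        then show ?thesis using z by simp
      qed
    qed
  qed
  have mean: "integrable lborel (\<lambda>x. f x p * g x $ i)" "(\<integral>x. f x p * g x $ i \<partial>lborel) = 0" for i
  proof -
    let ?\<phi> = "\<lambda>n x. (f x (p + c n *\<^sub>R axis i 1) - f x p) / c n"
    have one: "integrable lborel (\<lambda>x. f x q)" "(\<integral>x. f x q \<partial>lborel) = 1" if "q \<in> cball p \<alpha>" for q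
      using prob_space_density_imp_integral[of "\<lambda>x. f x q" lborel] meas[OF that] nonneg[OF that] prob[OF that]
      unfolding obs_law_def by auto
    have zero: "(\<integral>x. ?\<phi> n x \<partial>lborel) = 0" for n
      using one[OF p] one[OF cb[of n i]] by simp
    have conv: "AE x in lborel. (\<lambda>n. ?\<phi> n x) \<longlonglongrightarrow> f x p * g x $ i"
      using fg dom
    proof eventually_elim
      case (elim x)
      have h: "has_iter_partial [i] (f x) p" using elim(2) p by blast
      have "(\<lambda>n. (f x (p + c n *\<^sub>R axis i 1) - f x (p + 0 *\<^sub>R axis i 1)) / c n) \<longlonglongrightarrow> iter_partial [i] (f x) p"
        by (rule DERIV_imp_difference_quotient_tendsto[OF has_iter_partial_singleton_DERIV[OF h] c(1)])
          (use c(2) less_imp_neq in \<open>metis\<close>)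
      then show ?case using elim(1) by (simp del: iter_partial.simps)
    qed
    have bnd: "AE x in lborel. norm (?\<phi> n x) \<le> F\<^sub>1 x" for n
      using dom
    proof eventually_elim
      case (elim x)
      have "\<bar>f x (p + c n *\<^sub>R axis i 1) - f x p\<bar>
          \<le> F\<^sub>1 x * (\<Sum>a\<in>UNIV. \<bar>(p + c n *\<^sub>R axis i 1) $ a - p $ a\<bar>)"
        by (rule coordinate_path_lipschitz[OF _ _ cb]) (use elim in blast)+
      also have "(\<Sum>a\<in>UNIV. \<bar>(p + c n *\<^sub>R axis i 1) $ a - p $ a\<bar>) = (\<Sum>a\<in>UNIV. if a = i then c n else 0)"
        using c(2)[of n] by (intro sum.cong) (auto simp: axis_def)
      also have "\<dots> = c n" by simp
      finally show ?case using c(2)[of n] by (simp add: abs_divide pos_divide_le_eq)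
    qed
    have m: "(\<lambda>x. f x p * g x $ i) \<in> borel_measurable lborel" "?\<phi> n \<in> borel_measurable lborel" for n
      by simp_all
    show "integrable lborel (\<lambda>x. f x p * g x $ i)"
      by (rule integrable_dominated_convergence[OF m F1 conv bnd])
    have "(\<lambda>n. \<integral>x. ?\<phi> n x \<partial>lborel) \<longlonglongrightarrow> (\<integral>x. f x p * g x $ i \<partial>lborel)"
      by (rule integral_dominated_convergence[OF m F1 conv bnd])
    then show "(\<integral>x. f x p * g x $ i \<partial>lborel) = 0"
      unfolding zero using LIMSEQ_unique tendsto_const by blast
  qed
  have fnn: "AE x in lborel. 0 \<le> f x p" using nonneg[OF p] by simp
  \<comment> \<open>Where the density vanishes both sides are 0, whatever values \<open>ln\<close>
    and \<open>deriv\<close> take there.\<close>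
  have prod: "AE x in lborel. f x p * (g x $ i * g x $ j) =
      iter_partial [i] (\<lambda>q. ln (f x q)) p * iter_partial [j] (\<lambda>q. ln (f x q)) p * f x p" for i j
    using g_eq_leb
  proof eventually_elim
    case (elim x)
    then show ?case using nonneg[OF p, of x] by (cases "f x p = 0") (auto simp del: iter_partial.simps)
  qed
  have mg: "(\<lambda>x. f x p * (g x $ i * g x $ j)) \<in> borel_measurable lborel" for i j by simp
  show thesis
  proof (rule that[OF g g_eq]; (intro allI)?)
    show "integrable (obs_law f p) (\<lambda>x. g x $ i)" for i
      unfolding obs_law_def by (subst integrable_density) (auto simp: mean fnn)
    show "(\<integral>x. g x $ i \<partial>obs_law f p) = 0" for i
      unfolding obs_law_def by (subst integral_density) (auto simp: mean fnn)
    show "integrable (obs_law f p) (\<lambda>x. g x $ i * g x $ j)" for i j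
      unfolding obs_law_def
      by (subst integrable_density)
        (use integrable_cong_AE[OF mg _ prod, of i j] fish[of i j] in \<open>auto simp: fnn simp del: iter_partial.simps\<close>)
    show "(\<integral>x. g x $ i * g x $ j \<partial>obs_law f p) = fisher f p $ i $ j" for i j
      unfolding obs_law_def
      by (subst integral_density)
        (use integral_cong_AE[OF mg _ prod, of i j] fish[of i j] in \<open>auto simp: fnn fisher_def simp del: iter_partial.simps\<close>)
  qed
qed

lemma score_eq_sum:
  fixes f :: "real \<Rightarrow> real^'r::finite \<Rightarrow> real"
  assumes "\<And>k i. k < n \<Longrightarrow> has_iter_partial [i] (\<lambda>q. ln (f (x k) q)) p \<and>
        g (x k) $ i = iter_partial [i] (\<lambda>q. ln (f (x k) q)) p"
  shows "score f n x p = (\<Sum>k<n. g (x k))"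
proof -
  have "((\<lambda>u. \<Sum>k<n. ln (f (x k) (p + u *\<^sub>R axis i 1))) has_field_derivative (\<Sum>k<n. g (x k) $ i)) (at 0)" for i
  proof (rule DERIV_sum)
    fix k assume "k \<in> {..<n}"
    then show "((\<lambda>u. ln (f (x k) (p + u *\<^sub>R axis i 1))) has_field_derivative g (x k) $ i) (at 0)"
      using has_iter_partial_singleton_DERIV[of i "\<lambda>q. ln (f (x k) q)" p] assms[of k i]
      by (simp del: has_iter_partial.simps iter_partial.simps)
  qed
  then show ?thesis
    by (simp add: vec_eq_iff score_def loglik_def DERIV_imp_deriv)
qed

section \<open>The block information matrix\<close>

lemma sum_UNIV_sum_type:
  fixes g :: "'a::finite + 'b::finite \<Rightarrow> 'c::comm_monoid_add"
  shows "(\<Sum>a\<in>UNIV. g a) = (\<Sum>i\<in>UNIV. g (Inl i)) + (\<Sum>j\<in>UNIV. g (Inr j))"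
  using sum.Plus[of "UNIV :: 'a set" "UNIV :: 'b set" g] by simp

lemma stack_nth [simp]: "stack u v $ Inl i = u $ i" "stack u v $ Inr j = v $ j"
  by (simp_all add: stack_def)

lemma stack_cases:
  obtains u v where "z = stack u v"
proof
  show "z = stack (\<chi> i. z $ Inl i) (\<chi> j. z $ Inr j)"
    unfolding vec_eq_iff by (auto simp: stack_def split: sum.split)
qed

lemma stack_eq_iff [simp]: "stack u v = stack u' v' \<longleftrightarrow> u = u' \<and> v = v'"
proof
  assume "stack u v = stack u' v'"
  then have "stack u v $ Inl i = stack u' v' $ Inl i" "stack u v $ Inr j = stack u' v' $ Inr j" for i j
    by simp_all
  then show "u = u' \<and> v = v'" by (simp add: vec_eq_iff)
qed simp

lemma stack_zero [simp]: "stack 0 0 = 0"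
  by (simp add: vec_eq_iff split_sum_all)

lemma stack_eq_zero_iff [simp]: "stack u v = 0 \<longleftrightarrow> u = 0 \<and> v = 0"
  using stack_eq_iff[of u v 0 0] by simp

lemma inner_stack [simp]: "stack u v \<bullet> stack u' v' = u \<bullet> u' + v \<bullet> v'"
  by (simp add: inner_vec_def sum_UNIV_sum_type)

lemma norm_stack: "norm (stack u v) = sqrt ((norm u)\<^sup>2 + (norm v)\<^sup>2)"
  by (simp add: norm_eq_sqrt_inner)

lemma norm_stack_ge: "norm u \<le> norm (stack u v)" "norm v \<le> norm (stack u v)"
  by (simp_all add: norm_stack real_le_rsqrt)

lemma norm_stack_zero [simp]: "norm (stack u 0) = norm u"
  by (simp add: norm_stack)

lemma scaleR_stack: "c *\<^sub>R stack u v = stack (c *\<^sub>R u) (c *\<^sub>R v)"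
  by (simp add: vec_eq_iff split_sum_all)

lemma transpose_eq_nth:
  assumes "transpose A = A"
  shows "A $ i $ j = A $ j $ i"
proof -
  have "transpose A $ i $ j = A $ j $ i" by (simp add: transpose_def)
  then show ?thesis by (simp add: assms)
qed

lemma matrix_transpose_inner:
  "(A *v x) \<bullet> y = x \<bullet> (transpose A *v y)" for A :: "real^'a^'b"
  by (metis adjoint_matrix adjoint_works matrix_vector_mul_linear inner_commute)

lemma info_block_mult:
  "info_block B J K *v stack (stack x y) l =
     stack (stack (B *v x - J *v l) (- (K *v l))) (- (transpose J *v x) - transpose K *v y)"
  by (simp add: vec_eq_iff split_sum_all info_block_def matrix_vector_mult_def sum_UNIV_sum_type
      transpose_def sum_negf)

lemma transpose_info_block:
  assumes "transpose B = B"
  shows "transpose (info_block B J K) = info_block B J K"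
proof -
  have "B $ i $ j = B $ j $ i" for i j by (rule transpose_eq_nth[OF assms])
  then show ?thesis
    by (simp add: vec_eq_iff split_sum_all info_block_def transpose_def)
qed

text \<open>For a kernel vector (x, y, l), the three block rows give x . B x = (J^T x) . l = -y . (K
  l) = 0, so x = 0 by positive definiteness. What remains is J l = 0 and K^T y = 0, and both maps
  are injective by the rank conditions.\<close>

lemma invertible_info_block:
  fixes B :: "real^'r^'r" and J :: "real^'t^'r" and K :: "real^'t^'q"
  assumes B: "\<And>v. v \<noteq> 0 \<Longrightarrow> 0 < v \<bullet> (B *v v)"
    and J: "rank J = CARD('t)" and K: "rank K = CARD('q)"
  shows "invertible (info_block B J K)"
  unfolding invertible_left_inverse matrix_left_invertible_ker
proof safe
  fix z assume z: "info_block B J K *v z = 0"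
  obtain a l where "z = stack a l" by (rule stack_cases)
  moreover obtain x y where "a = stack x y" by (rule stack_cases)
  ultimately have zs: "z = stack (stack x y) l" by simp
  have z': "B *v x - J *v l = 0" "- (K *v l) = 0" "- (transpose J *v x) - transpose K *v y = 0"
    using z unfolding zs info_block_mult stack_eq_zero_iff by auto
  have eqs: "B *v x = J *v l" "K *v l = 0" using z' by auto
  have eq3: "transpose J *v x = - (transpose K *v y)"
    using z'(3) by (metis eq_iff_diff_eq_0 minus_minus)
  have "x \<bullet> (B *v x) = (transpose J *v x) \<bullet> l"
    unfolding eqs(1) by (metis inner_commute matrix_transpose_inner)
  also have "\<dots> = - (y \<bullet> (K *v l))"
    unfolding eq3 by (metis inner_commute inner_minus_left matrix_transpose_inner)
  finally have "x \<bullet> (B *v x) = 0" by (simp add: eqs(2))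
  then have x: "x = 0" using B[of x] by auto
  have "J *v l = J *v 0" using eqs(1) x by simp
  then have l: "l = 0" using J full_rank_injective by (metis injD)
  have "transpose K *v y = transpose K *v 0" using eq3 x by simp
  then have "y = 0" using K full_rank_injective rank_transpose by (metis injD)
  then show "z = 0" by (simp add: zs x l)
qed

lemma matrix_inv:
  fixes A :: "real^'n^'n"
  assumes "invertible A"
  shows "A ** matrix_inv A = mat 1" "matrix_inv A ** A = mat 1"
proof -
  have "\<exists>A'. A ** A' = mat 1 \<and> A' ** A = mat 1" using assms by (simp add: invertible_def)
  from someI_ex[OF this] show "A ** matrix_inv A = mat 1" "matrix_inv A ** A = mat 1"
    by (simp_all add: matrix_inv_def)
qed

lemma matrix_inv_transpose_sym:
  fixes A :: "real^'n^'n"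
  assumes "invertible A" "transpose A = A"
  shows "transpose (matrix_inv A) = matrix_inv A"
proof -
  have "A ** matrix_inv A = mat 1" "matrix_inv A ** A = mat 1"
    using matrix_inv[OF assms(1)] by auto
  then have "transpose (matrix_inv A) ** A = mat 1"
    by (metis assms(2) matrix_transpose_mul transpose_mat)
  then show ?thesis
    by (metis \<open>A ** matrix_inv A = mat 1\<close> matrix_mul_assoc matrix_mul_lid matrix_mul_rid)
qed

lemma transpose_asymp_cov:
  assumes "transpose P = P"
  shows "transpose (asymp_cov P) = asymp_cov P"
proof -
  have "P $ i $ j = P $ j $ i" for i j by (rule transpose_eq_nth[OF assms])
  then show ?thesis by (simp add: vec_eq_iff split_sum_all asymp_cov_def transpose_def)
qed

text \<open>Flipping the sign of the lower block on one side only makes the two cross terms cancel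
  by symmetry and negates the lower diagonal term.\<close>

lemma asymp_cov_quadratic_form:
  assumes "transpose P = P"
  shows "stack u v \<bullet> (asymp_cov P *v stack u v) = stack u (- v) \<bullet> (P *v stack u v)"
proof -
  have sym: "P $ i $ j = P $ j $ i" for i j by (rule transpose_eq_nth[OF assms])
  have "(\<Sum>i\<in>UNIV. \<Sum>k\<in>UNIV. u $ i * (P $ Inl i $ Inr k * v $ k))
      = (\<Sum>k\<in>UNIV. \<Sum>i\<in>UNIV. v $ k * (P $ Inr k $ Inl i * u $ i))"
    by (subst sum.swap) (simp add: sym[of "Inl _" "Inr _"] mult_ac)
  then show ?thesis
    by (simp add: inner_vec_def matrix_vector_mult_def sum_UNIV_sum_type asymp_cov_def
        sum_distrib_left distrib_left sum.distrib sum_negf)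
qed

text \<open>With \<open>P\<close> the inverse of the information matrix \<open>A\<close>, writing \<open>u = A z\<close> makes all terms in
  \<open>J\<close> and \<open>K\<close> cancel.\<close>

lemma asymp_cov_info_block:
  fixes B :: "real^'r::finite^'r" and J :: "real^'t::finite^'r" and K :: "real^'t^'q::finite"
  defines "A \<equiv> info_block B J K"
  assumes inv: "invertible A" and B: "transpose B = B"
    and z: "matrix_inv A *v u = stack (stack x y) l"
  shows "u \<bullet> (asymp_cov (matrix_inv A) *v u) = x \<bullet> (B *v x)"
proof -
  have symA: "transpose A = A" unfolding A_def by (rule transpose_info_block[OF B])
  have "u = A *v (matrix_inv A *v u)"
    using matrix_inv(1)[OF inv] by (simp add: matrix_vector_mul_assoc)
  then have u: "u = stack (stack (B *v x - J *v l) (- (K *v l))) (- (transpose J *v x) - transpose K *v y)"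
    (is "_ = stack ?u1 ?u2") unfolding z by (simp only: A_def info_block_mult)
  have "u \<bullet> (asymp_cov (matrix_inv A) *v u) = stack ?u1 (- ?u2) \<bullet> (matrix_inv A *v u)"
    unfolding u by (rule asymp_cov_quadratic_form[OF matrix_inv_transpose_sym[OF inv symA]])
  also have "\<dots> = (B *v x) \<bullet> x - (J *v l) \<bullet> x - (K *v l) \<bullet> y
      + ((transpose J *v x) \<bullet> l + (transpose K *v y) \<bullet> l)"
    unfolding z by (simp add: inner_diff_left inner_add_left del: transpose_matrix_vector)
  also have "\<dots> = x \<bullet> (B *v x)"
    unfolding matrix_transpose_inner[of J] matrix_transpose_inner[of K]
    by (simp add: inner_commute del: transpose_matrix_vector)
  finally show ?thesis .
qed

section \<open>Linearization of the likelihood equations\<close>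

lemma has_iter_partial_inner:
  assumes "has_iter_partial [a, b, i] g v"
  shows "has_iter_partial [a, b] (iter_partial [i] g) v"
  using assms by (auto elim!: eventually_mono)

lemma norm_le_card_times_bound:
  fixes z :: "real^'i::finite"
  assumes "\<And>a. \<bar>z $ a\<bar> \<le> c"
  shows "norm z \<le> real CARD('i) * c"
  using norm_le_l1_cart[of z] sum_bounded_above[of UNIV "\<lambda>a. \<bar>z $ a\<bar>" c] assms by auto

lemma abs_sum_mult_le:
  fixes z :: "real^'i::finite"
  assumes "\<And>a. \<bar>b a\<bar> \<le> c"
  shows "\<bar>\<Sum>a\<in>UNIV. b a * z $ a\<bar> \<le> real CARD('i) * (c * norm z)"
proof -
  have c: "0 \<le> c" using assms[of undefined] by linarith
  have "\<bar>\<Sum>a\<in>UNIV. b a * z $ a\<bar> \<le> (\<Sum>a\<in>UNIV. \<bar>b a * z $ a\<bar>)" by (rule sum_abs)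
  also have "\<dots> \<le> (\<Sum>a\<in>(UNIV::'i set). c * norm z)"
    unfolding abs_mult by (intro sum_mono mult_mono assms component_le_norm_cart c) auto
  finally show ?thesis by simp
qed

lemma fisher_symmetric: "transpose (fisher f p) = fisher f p"
  by (simp add: fisher_def transpose_def vec_eq_iff mult.commute)

lemma phi_part_stack: "w = stack (phi_part w) (\<chi> j. w $ Inr j)"
  by (simp add: vec_eq_iff split_sum_all phi_part_def)

lemma norm_phi_part_diff: "norm (phi_part w - phi_part w') \<le> norm (w - w')"
proof -
  have "phi_part w - phi_part w' = phi_part (w - w')" by (simp add: phi_part_def vec_eq_iff)
  also have "norm \<dots> \<le> norm (w - w')"
    using norm_stack_ge(1)[of "phi_part (w - w')" "\<chi> j. (w - w') $ Inr j"]
    unfolding phi_part_stack[symmetric] .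
  finally show ?thesis .
qed

text \<open>Each score component is expanded to second order. Replacing the Hessian by minus the
  Fisher matrix costs \<open>d\<close> times a matrix with entries of modulus at most 1, giving the
  summand r of the constant. The third derivatives give the other summand, where one of the two
  factors \<open>norm (q - p)\<close> is weakened to \<open>d\<close>.\<close>

lemma score_expansion:
  fixes f :: "real \<Rightarrow> real^'r::finite \<Rightarrow> real"
  assumes n: "0 < n"
    and diff: "\<And>q i j k. q \<in> cball p \<alpha> \<Longrightarrow> has_iter_partial [i, j, k] (loglik f n x) q"
    and third: "\<And>q i j k. q \<in> cball p \<alpha> \<Longrightarrow> \<bar>iter_partial [i, j, k] (loglik f n x) q / real n\<bar> < 2 * \<kappa>\<^sub>1"
    and m: "\<And>i j. \<bar>m $ i $ j\<bar> \<le> 1" and hess: "hess f n x p /\<^sub>R real n = - fisher f p + d *\<^sub>R m"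
    and q: "norm (q - p) \<le> d" "d \<le> \<alpha>"
  shows "\<bar>(score f n x q /\<^sub>R real n) $ i - (score f n x p /\<^sub>R real n) $ i + (fisher f p *v (q - p)) $ i\<bar>
    \<le> (2 * \<kappa>\<^sub>1 * (real CARD('r))\<^sup>2 + real CARD('r)) * d * norm (q - p)"
proof -
  let ?g = "iter_partial [i] (loglik f n x)" and ?N = "real n" and ?r = "real CARD('r)"
  have d: "0 \<le> d" using q(1) norm_ge_zero order_trans by blast
  have q': "q \<in> cball p \<alpha>" using q by (simp add: dist_norm norm_minus_commute)
  have \<kappa>: "0 \<le> \<kappa>\<^sub>1" using third[OF q', of undefined undefined undefined] by linarith
  have taylor: "\<bar>?g q - ?g p - (\<Sum>a\<in>UNIV. iter_partial [a] ?g p * (q $ a - p $ a))\<bar>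
      \<le> (2 * \<kappa>\<^sub>1 * ?N) * (?r * norm (q - p)) * (?r * norm (q - p))"
  proof (rule coordinate_path_second_order[OF _ _ q'])
    fix v a b assume v: "v \<in> cball p \<alpha>"
    show "has_iter_partial [a, b] ?g v" by (rule has_iter_partial_inner[OF diff[OF v]])
    have "\<bar>iter_partial [a, b, i] (loglik f n x) v\<bar> \<le> 2 * \<kappa>\<^sub>1 * ?N"
      using third[OF v, of a b i] n by (simp add: divide_simps del: iter_partial.simps)
    then show "\<bar>iter_partial [a, b] ?g v\<bar> \<le> 2 * \<kappa>\<^sub>1 * ?N" by simp
  qed
  \<comment> \<open>The index \<open>i\<close> is differentiated innermost, so the Hessian entry
    sits at (a, i); symmetry of the Fisher matrix moves its entry to row \<open>i\<close>, while
    \<open>m\<close> keeps its position.\<close>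
  have hess_nth: "iter_partial [a] ?g p / ?N = - fisher f p $ i $ a + d * m $ a $ i" for a
  proof -
    have "iter_partial [a] ?g p / ?N = (hess f n x p /\<^sub>R ?N) $ a $ i"
      by (simp add: hess_def divide_inverse_commute)
    also have "\<dots> = - fisher f p $ a $ i + d * m $ a $ i" by (simp add: hess)
    finally show ?thesis by (simp only: transpose_eq_nth[OF fisher_symmetric, of f p a i])
  qed
  have sc: "(score f n x y /\<^sub>R ?N) $ i = ?g y / ?N" for y
    by (simp add: score_def divide_inverse_commute)
  have "(\<Sum>a\<in>UNIV. iter_partial [a] ?g p * (q $ a - p $ a)) / ?N
      = (\<Sum>a\<in>UNIV. (- fisher f p $ i $ a + d * m $ a $ i) * (q - p) $ a)"
    unfolding sum_divide_distrib hess_nth[symmetric] by simp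
  also have "\<dots> = - (fisher f p *v (q - p)) $ i + d * (\<Sum>a\<in>UNIV. m $ a $ i * (q - p) $ a)"
    by (simp add: matrix_vector_mult_def algebra_simps sum.distrib sum_subtractf sum_distrib_left)
  finally have split: "(score f n x q /\<^sub>R ?N) $ i - (score f n x p /\<^sub>R ?N) $ i + (fisher f p *v (q - p)) $ i
      = (?g q - ?g p - (\<Sum>a\<in>UNIV. iter_partial [a] ?g p * (q $ a - p $ a))) / ?N
        + d * (\<Sum>a\<in>UNIV. m $ a $ i * (q - p) $ a)"
    unfolding sc by (simp add: diff_divide_distrib del: iter_partial.simps)
  have "\<bar>(?g q - ?g p - (\<Sum>a\<in>UNIV. iter_partial [a] ?g p * (q $ a - p $ a))) / ?N\<bar>
      \<le> (2 * \<kappa>\<^sub>1 * ?N) * (?r * norm (q - p)) * (?r * norm (q - p)) / ?N"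
    unfolding abs_divide abs_of_nat by (rule divide_right_mono[OF taylor]) simp
  also have "\<dots> = 2 * \<kappa>\<^sub>1 * ?r\<^sup>2 * norm (q - p) * norm (q - p)"
    using n by (simp add: power2_eq_square)
  also have "\<dots> \<le> 2 * \<kappa>\<^sub>1 * ?r\<^sup>2 * d * norm (q - p)"
    using q(1) \<kappa> by (intro mult_right_mono mult_left_mono) auto
  finally have 1: "\<bar>(?g q - ?g p - (\<Sum>a\<in>UNIV. iter_partial [a] ?g p * (q $ a - p $ a))) / ?N\<bar>
      \<le> 2 * \<kappa>\<^sub>1 * ?r\<^sup>2 * d * norm (q - p)" .
  have "\<bar>d * (\<Sum>a\<in>UNIV. m $ a $ i * (q - p) $ a)\<bar> \<le> d * (?r * (1 * norm (q - p)))"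
    unfolding abs_mult abs_of_nonneg[OF d] by (intro mult_left_mono abs_sum_mult_le m d)
  also have "\<dots> = ?r * d * norm (q - p)" by simp
  finally show ?thesis using 1 unfolding split distrib_right by linarith
qed

text \<open>Three errors add up: \<open>?c1\<close> from expanding the score, \<open>?c2\<close>
  from the Lipschitz change of the first derivatives of \<open>h\<close> applied to
  \<open>l\<close>, and \<open>?c3\<close> from the second-order remainder of \<open>h\<close>
  itself. The factor \<open>?D\<close> passes from entries to the norm.\<close>

lemma likelihood_equations_linearized:
  fixes f :: "real \<Rightarrow> real^'r::finite \<Rightarrow> real"
    and h :: "real^('r + 'q::finite) \<Rightarrow> real^'t::finite"
  assumes n: "0 < n"
    and h: "constraint_conditions h w0 \<alpha> \<kappa>\<^sub>2" "h w0 = 0"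
    and diff: "\<And>q i j k. q \<in> cball (phi_part w0) \<alpha> \<Longrightarrow> has_iter_partial [i, j, k] (loglik f n x) q"
    and third: "\<And>q i j k. q \<in> cball (phi_part w0) \<alpha> \<Longrightarrow>
        \<bar>iter_partial [i, j, k] (loglik f n x) q / real n\<bar> < 2 * \<kappa>\<^sub>1"
    and m: "\<And>i j. \<bar>m $ i $ j\<bar> \<le> 1"
    and hess: "hess f n x (phi_part w0) /\<^sub>R real n = - fisher f (phi_part w0) + d *\<^sub>R m"
    and eqs: "likelihood_equations f h n x w l" and w: "norm (w - w0) \<le> d" "d \<le> \<alpha>"
  shows "norm (info_block (fisher f (phi_part w0)) (jacJ h w0) (jacK h w0) *v stack (w - w0) l
      - stack (stack (score f n x (phi_part w0) /\<^sub>R real n) 0) 0)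
    \<le> real CARD(('r + 'q) + 't) * (2 * \<kappa>\<^sub>1 * (real CARD('r))\<^sup>2 + real CARD('r)
        + 2 * \<kappa>\<^sub>2 * real CARD('r + 'q) * real CARD('t) + 2 * \<kappa>\<^sub>2 * (real CARD('r + 'q))\<^sup>2)
        * d * norm (stack (w - w0) l)"
    (is "norm (?A *v ?z - ?S) \<le> ?D * (?c1 + ?c2 + ?c3) * d * _")
proof -
  define p where "p = phi_part w0"
  define q where "q = phi_part w"
  define \<psi> where "\<psi> = (\<chi> j. (w - w0) $ Inr j)"
  let ?s = "real CARD('r + 'q)"
  have d: "0 \<le> d" using w(1) norm_ge_zero order_trans by blast
  have w': "w \<in> cball w0 \<alpha>" using w by (simp add: dist_norm norm_minus_commute)
  have hd: "\<And>v a b k. v \<in> cball w0 \<alpha> \<Longrightarrow> has_iter_partial [a, b] (\<lambda>v. h v $ k) v"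
    and hb: "\<And>v a b k. v \<in> cball w0 \<alpha> \<Longrightarrow> \<bar>iter_partial [a, b] (\<lambda>v. h v $ k) v\<bar> \<le> 2 * \<kappa>\<^sub>2"
    using h(1) unfolding constraint_conditions_def by blast+
  have \<kappa>2: "0 \<le> \<kappa>\<^sub>2" using hb[OF w', of undefined undefined undefined] by linarith
  have p_in: "p \<in> cball p \<alpha>" using d w(2) by simp
  have \<kappa>1: "0 \<le> \<kappa>\<^sub>1"
    using third[of p undefined undefined undefined] p_in unfolding p_def[symmetric] by linarith
  have qp: "norm (q - p) \<le> norm (w - w0)" unfolding q_def p_def by (rule norm_phi_part_diff)
  have zw: "norm (w - w0) \<le> norm ?z" "norm l \<le> norm ?z" by (rule norm_stack_ge)+
  have ws: "w - w0 = stack (q - p) \<psi>"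
    by (simp add: vec_eq_iff split_sum_all q_def p_def \<psi>_def phi_part_def)
  have c: "0 \<le> ?c1" "0 \<le> ?c2" "0 \<le> ?c3" using \<kappa>1 \<kappa>2 by auto
  have lip: "\<bar>iter_partial [a] (\<lambda>v. h v $ k) w - iter_partial [a] (\<lambda>v. h v $ k) w0\<bar> \<le> 2 * \<kappa>\<^sub>2 * ?s * d" for a k
  proof -
    have "\<bar>iter_partial [a] (\<lambda>v. h v $ k) w - iter_partial [a] (\<lambda>v. h v $ k) w0\<bar>
        \<le> 2 * \<kappa>\<^sub>2 * (?s * norm (w - w0))"
      by (rule iter_partial_lipschitz[OF hd hb w'])
    also have "\<dots> \<le> 2 * \<kappa>\<^sub>2 * (?s * d)" using w(1) \<kappa>2 by (intro mult_left_mono) auto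
    finally show ?thesis by (simp add: mult_ac)
  qed
  have row: "\<bar>\<Sum>k\<in>UNIV. (iter_partial [a] (\<lambda>v. h v $ k) w - iter_partial [a] (\<lambda>v. h v $ k) w0) * l $ k\<bar>
      \<le> ?c2 * d * norm ?z" for a
  proof -
    have "\<bar>\<Sum>k\<in>UNIV. (iter_partial [a] (\<lambda>v. h v $ k) w - iter_partial [a] (\<lambda>v. h v $ k) w0) * l $ k\<bar>
        \<le> real CARD('t) * (2 * \<kappa>\<^sub>2 * ?s * d * norm l)"
      by (rule abs_sum_mult_le[OF lip])
    also have "\<dots> = ?c2 * d * norm l" by (simp add: mult_ac)
    also have "\<dots> \<le> ?c2 * d * norm ?z" using c d zw by (intro mult_left_mono) auto
    finally show ?thesis .
  qed
  have eq1: "score f n x q /\<^sub>R real n + jacJ h w *v l = 0"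
    and eq2: "jacK h w *v l = 0" and eq3: "h w = 0"
    using eqs unfolding likelihood_equations_def q_def by auto
  have le_total: "a \<le> ?c1 * d * norm ?z + ?c2 * d * norm ?z \<Longrightarrow> a \<le> (?c1 + ?c2 + ?c3) * d * norm ?z"
    "a \<le> ?c2 * d * norm ?z \<Longrightarrow> a \<le> (?c1 + ?c2 + ?c3) * d * norm ?z"
    "a \<le> ?c3 * d * norm ?z \<Longrightarrow> a \<le> (?c1 + ?c2 + ?c3) * d * norm ?z" for a
    using c d mult_nonneg_nonneg[OF mult_nonneg_nonneg[OF c(1) d] norm_ge_zero[of ?z]]
      mult_nonneg_nonneg[OF mult_nonneg_nonneg[OF c(2) d] norm_ge_zero[of ?z]]
      mult_nonneg_nonneg[OF mult_nonneg_nonneg[OF c(3) d] norm_ge_zero[of ?z]]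
    unfolding distrib_right by linarith+
  have "\<bar>(?A *v ?z - ?S) $ b\<bar> \<le> (?c1 + ?c2 + ?c3) * d * norm ?z" for b
  proof -
    consider (phi) i where "b = Inl (Inl i)" | (psi) i where "b = Inl (Inr i)" | (lam) k where "b = Inr k"
      by (metis obj_sumE)
    then show ?thesis
    proof cases
      case phi
      \<comment> \<open>The first likelihood equation trades the score at \<open>q\<close> for the
        Jacobian at \<open>w\<close> applied to \<open>l\<close>, so that only differences against
        the values at \<open>w0\<close> remain.\<close>
      have "(?A *v ?z - ?S) $ b = ((score f n x q /\<^sub>R real n) $ i - (score f n x p /\<^sub>R real n) $ i
            + (fisher f p *v (q - p)) $ i)
          + (\<Sum>k\<in>UNIV. (iter_partial [Inl i] (\<lambda>v. h v $ k) w - iter_partial [Inl i] (\<lambda>v. h v $ k) w0) * l $ k)"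
      proof -
        have "(score f n x q /\<^sub>R real n) $ i = - (jacJ h w *v l) $ i"
          using eq1 by (metis add_eq_0_iff2 vector_uminus_component)
        moreover have "(\<Sum>k\<in>UNIV. (iter_partial [Inl i] (\<lambda>v. h v $ k) w - iter_partial [Inl i] (\<lambda>v. h v $ k) w0) * l $ k)
           = (jacJ h w *v l) $ i - (jacJ h w0 *v l) $ i"
          by (simp add: jacJ_def matrix_vector_mult_def left_diff_distrib sum_subtractf del: iter_partial.simps)
        ultimately show ?thesis
          unfolding ws info_block_mult p_def[symmetric] phi by simp
      qed
      moreover have "\<bar>(score f n x q /\<^sub>R real n) $ i - (score f n x p /\<^sub>R real n) $ i
            + (fisher f p *v (q - p)) $ i\<bar> \<le> ?c1 * d * norm (q - p)"
        by (rule score_expansion[OF n _ _ m _ _ w(2)])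
          (use diff third hess w(1) qp in \<open>auto simp: p_def simp del: iter_partial.simps has_iter_partial.simps\<close>)
      moreover have "?c1 * d * norm (q - p) \<le> ?c1 * d * norm ?z"
        using c d qp zw by (intro mult_left_mono) auto
      ultimately show ?thesis using row[of "Inl i"] by (intro le_total(1)) linarith
    next
      case psi
      have "(?A *v ?z - ?S) $ b
          = (\<Sum>k\<in>UNIV. (iter_partial [Inr i] (\<lambda>v. h v $ k) w - iter_partial [Inr i] (\<lambda>v. h v $ k) w0) * l $ k)"
      proof -
        have "(jacK h w *v l) $ i = 0" using eq2 by simp
        moreover have "(\<Sum>k\<in>UNIV. (iter_partial [Inr i] (\<lambda>v. h v $ k) w - iter_partial [Inr i] (\<lambda>v. h v $ k) w0) * l $ k)
           = (jacK h w *v l) $ i - (jacK h w0 *v l) $ i"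
          by (simp add: jacK_def matrix_vector_mult_def left_diff_distrib sum_subtractf del: iter_partial.simps)
        ultimately show ?thesis
          unfolding ws info_block_mult p_def[symmetric] psi by simp
      qed
      then show ?thesis using row[of "Inr i"] by (intro le_total(2)) simp
    next
      case lam
      have "(?A *v ?z - ?S) $ b = h w $ k - h w0 $ k
          - (\<Sum>a\<in>UNIV. iter_partial [a] (\<lambda>v. h v $ k) w0 * (w $ a - w0 $ a))"
      proof -
        have "(\<Sum>a\<in>UNIV. iter_partial [a] (\<lambda>v. h v $ k) w0 * (w $ a - w0 $ a))
            = (transpose (jacJ h w0) *v (q - p)) $ k + (transpose (jacK h w0) *v \<psi>) $ k"
          unfolding vector_minus_component[symmetric] ws
          by (simp add: sum_UNIV_sum_type jacJ_def jacK_def matrix_vector_mult_def transpose_def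
              del: iter_partial.simps transpose_matrix_vector)
        then show ?thesis
          unfolding ws info_block_mult p_def[symmetric] lam
          by (simp add: h(2) eq3 del: iter_partial.simps transpose_matrix_vector)
      qed
      moreover have "\<bar>h w $ k - h w0 $ k
          - (\<Sum>a\<in>UNIV. iter_partial [a] (\<lambda>v. h v $ k) w0 * (w $ a - w0 $ a))\<bar>
          \<le> 2 * \<kappa>\<^sub>2 * (?s * norm (w - w0)) * (?s * norm (w - w0))"
        by (rule coordinate_path_second_order[OF hd hb w'])
      moreover have "2 * \<kappa>\<^sub>2 * (?s * norm (w - w0)) * (?s * norm (w - w0)) = ?c3 * norm (w - w0) * norm (w - w0)"
        by (simp add: power2_eq_square mult_ac)
      moreover have "?c3 * norm (w - w0) * norm (w - w0) \<le> ?c3 * d * norm ?z"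
        using c d w(1) zw \<kappa>2 by (intro mult_mono) auto
      ultimately show ?thesis by (intro le_total(3)) linarith
    qed
  qed
  then have "norm (?A *v ?z - ?S) \<le> ?D * ((?c1 + ?c2 + ?c3) * d * norm ?z)"
    by (rule norm_le_card_times_bound)
  then show ?thesis by (simp only: mult.assoc)
qed

text \<open>The bound on \<open>z - P *v s = P *v (A *v z - s)\<close> is used twice: with factor
  1/2 it yields \<open>norm z\<close> at most twice \<open>norm (P *v s)\<close>, and reinserting
  this recovers the small factor \<open>e\<close>.\<close>

lemma perturbed_linear_solution:
  fixes A P :: "real^'n::finite^'n"
  assumes inv: "P ** A = mat 1"
    and P: "\<And>x. norm (P *v x) \<le> c * norm x" and c: "0 \<le> c"
    and resid: "norm (A *v z - s) \<le> e * norm z" and small: "c * e \<le> 1/2" and e: "0 \<le> e"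
  shows "norm (z - P *v s) \<le> 2 * c\<^sup>2 * e * norm s"
proof -
  have "z - P *v s = P *v (A *v z - s)"
    by (simp add: matrix_vector_mult_diff_distrib matrix_vector_mul_assoc inv)
  then have "norm (z - P *v s) \<le> c * norm (A *v z - s)" using P by simp
  also have "\<dots> \<le> c * (e * norm z)" by (intro mult_left_mono resid c)
  finally have 1: "norm (z - P *v s) \<le> (c * e) * norm z" by simp
  also have "\<dots> \<le> 1/2 * norm z" by (intro mult_right_mono small) auto
  finally have "norm z \<le> 2 * norm (P *v s)"
    using norm_triangle_sub[of z "P *v s"] by linarith
  then have "norm z \<le> 2 * (c * norm s)" using P[of s] by linarith
  then have "(c * e) * norm z \<le> (c * e) * (2 * (c * norm s))"
    using c e by (intro mult_left_mono) auto
  with 1 show ?thesis by (simp add: power2_eq_square mult_ac)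
qed

section \<open>Asymptotic normality\<close>

lemma measurable_stack:
  fixes u :: "'a \<Rightarrow> real^'b::finite" and v :: "'a \<Rightarrow> real^'c::finite"
  assumes [measurable]: "u \<in> borel_measurable M" "v \<in> borel_measurable M"
  shows "(\<lambda>x. stack (u x) (v x)) \<in> borel_measurable M"
proof -
  have "linear (\<lambda>u::real^'b. stack u (0::real^'c))" "linear (\<lambda>v::real^'c. stack (0::real^'b) v)"
    by (auto intro!: linearI simp: vec_eq_iff split_sum_all)
  then have [measurable]: "(\<lambda>u::real^'b. stack u (0::real^'c)) \<in> borel_measurable borel"
      "(\<lambda>v::real^'c. stack (0::real^'b) v) \<in> borel_measurable borel"
    by (auto intro!: borel_measurable_continuous_onI linear_continuous_on simp: linear_conv_bounded_linear)
  have "(\<lambda>x. stack (u x) 0 + stack 0 (v x)) \<in> borel_measurable M" by measurable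
  then show ?thesis by (rule measurable_cong[THEN iffD1, rotated]) (simp add: vec_eq_iff split_sum_all)
qed

lemma measurable_matrix_vector_mult:
  fixes A :: "real^'n::finite^'m::finite"
  assumes [measurable]: "u \<in> borel_measurable M"
  shows "(\<lambda>x. A *v u x) \<in> borel_measurable M"
proof -
  have [measurable]: "(*v) A \<in> borel_measurable borel"
    by (intro borel_measurable_continuous_onI linear_continuous_on)
      (simp add: linear_conv_bounded_linear[symmetric])
  show ?thesis by measurable
qed

lemma norm_iexp_diff_le: "norm (iexp a - iexp b) \<le> \<bar>a - b\<bar>" for a b :: real
proof -
  have "iexp a - iexp b = iexp b * (iexp (a - b) - 1)"
    by (simp add: algebra_simps exp_diff)
  then have "norm (iexp a - iexp b) = norm (iexp (a - b) - 1)"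
    by (simp add: norm_mult)
  also have "\<dots> \<le> \<bar>a - b\<bar>" using iexp_approx1[of "a - b" 0] by simp
  finally show ?thesis .
qed

context prob_space
begin

lemma integrable_iexp_inner:
  fixes T :: "'a \<Rightarrow> 'b::euclidean_space"
  assumes [measurable]: "T \<in> borel_measurable M"
  shows "integrable M (\<lambda>x. iexp (u \<bullet> T x))"
  by (rule integrable_const_bound[of _ 1]) (auto intro!: AE_I2)

lemma integral_cos_sin_eq_Re_Im:
  fixes T :: "'a \<Rightarrow> 'b::euclidean_space"
  assumes T: "T \<in> borel_measurable M"
  shows "(\<integral>x. cos (u \<bullet> T x) \<partial>M) = Re (CLINT x|M. iexp (u \<bullet> T x))"
    "(\<integral>x. sin (u \<bullet> T x) \<partial>M) = Im (CLINT x|M. iexp (u \<bullet> T x))"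
  using integral_Re[OF integrable_iexp_inner[OF T, of u]] integral_Im[OF integrable_iexp_inner[OF T, of u]]
  by (simp_all add: Re_exp Im_exp)

text \<open>The phase is 1-Lipschitz, so an almost sure bound by \<open>e * R\<close> needs only the
  mean of \<open>R\<close>, and no estimate of probabilities.\<close>

lemma char_perturbation:
  fixes T V :: "'a \<Rightarrow> 'b::euclidean_space"
  assumes T: "T \<in> borel_measurable M" and V: "V \<in> borel_measurable M"
    and close: "AE x in M. norm (T x - V x) \<le> e * R x"
    and R: "integrable M R" "(\<integral>x. R x \<partial>M) \<le> C" and e: "0 \<le> e"
  shows "norm ((CLINT x|M. iexp (u \<bullet> T x)) - (CLINT x|M. iexp (u \<bullet> V x))) \<le> norm u * e * C"
proof -
  have "norm ((CLINT x|M. iexp (u \<bullet> T x)) - (CLINT x|M. iexp (u \<bullet> V x)))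
      = norm (CLINT x|M. iexp (u \<bullet> T x) - iexp (u \<bullet> V x))"
    by (subst Bochner_Integration.integral_diff) (auto intro: integrable_iexp_inner T V)
  also have "\<dots> \<le> (\<integral>x. norm (iexp (u \<bullet> T x) - iexp (u \<bullet> V x)) \<partial>M)"
    by (rule integral_norm_bound)
  also have "\<dots> \<le> (\<integral>x. norm u * e * R x \<partial>M)"
  proof (rule integral_mono_AE)
    show "integrable M (\<lambda>x. norm (iexp (u \<bullet> T x) - iexp (u \<bullet> V x)))"
      by (intro integrable_norm Bochner_Integration.integrable_diff integrable_iexp_inner T V)
    show "integrable M (\<lambda>x. norm u * e * R x)" using R by simp
    show "AE x in M. norm (iexp (u \<bullet> T x) - iexp (u \<bullet> V x)) \<le> norm u * e * R x"
      using close
    proof eventually_elim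
      case (elim x)
      have "norm (iexp (u \<bullet> T x) - iexp (u \<bullet> V x)) \<le> \<bar>u \<bullet> (T x - V x)\<bar>"
        using norm_iexp_diff_le[of "u \<bullet> T x" "u \<bullet> V x"] by (simp add: inner_diff_right)
      also have "\<dots> \<le> norm u * norm (T x - V x)" by (rule Cauchy_Schwarz_ineq2)
      also have "\<dots> \<le> norm u * (e * R x)" by (intro mult_left_mono elim) auto
      finally show ?case by simp
    qed
  qed
  also have "\<dots> \<le> norm u * e * C" using R e by (simp add: mult_left_mono)
  finally show ?thesis .
qed

text \<open>Markov's inequality; with \<open>C\<close> free of the sample size it provides
  tightness.\<close>

lemma prob_norm_gt_le:
  fixes T :: "'a \<Rightarrow> 'b::euclidean_space"
  assumes [measurable]: "T \<in> borel_measurable M"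
    and bound: "AE x in M. norm (T x) \<le> R x"
    and R: "integrable M R" "(\<integral>x. R x \<partial>M) \<le> C" and r: "0 < r"
  shows "measure (distr M borel T) (UNIV - cball 0 r) \<le> C / r"
proof -
  have int: "integrable M (\<lambda>x. norm (T x))"
    by (rule Bochner_Integration.integrable_bound[OF R(1)])
      (use bound in \<open>auto elim!: eventually_mono\<close>)
  have "measure (distr M borel T) (UNIV - cball 0 r) = prob (T -` (UNIV - cball 0 r) \<inter> space M)"
    by (rule measure_distr) auto
  also have "\<dots> \<le> prob {x \<in> space M. norm (T x) \<ge> r}"
    by (intro finite_measure_mono) auto
  also have "\<dots> \<le> (\<integral>x. norm (T x) \<partial>M) / r"
    by (rule integral_Markov_inequality_measure[OF int, where A="{}"]) (use r in auto)
  also have "(\<integral>x. norm (T x) \<partial>M) \<le> (\<integral>x. R x \<partial>M)"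
    by (rule integral_mono_AE[OF int R(1) bound])
  finally show ?thesis using R(2) r by (simp add: divide_right_mono order_trans)
qed

end

text \<open>\<open>Suc m\<close> is the least index whose threshold exceeds \<open>n\<close>. The
  block containing \<open>n\<close> decides which radius governs the estimator at that sample
  size.\<close>

lemma strict_mono_bracket:
  fixes N :: "nat \<Rightarrow> nat"
  assumes "strict_mono N" "N m0 \<le> n"
  obtains m where "m0 \<le> m" "N m \<le> n" "n < N (Suc m)"
proof -
  define k where "k = (LEAST k. n < N k)"
  have ex: "n < N (Suc n)" using strict_mono_imp_increasing[OF assms(1), of "Suc n"] by simp
  have k: "n < N k" unfolding k_def by (rule LeastI[of _ "Suc n"]) (rule ex)
  have "m0 < k"
    using k assms by (metis leD le_less_linear le_less_trans strict_mono_less_eq)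
  then obtain m where m: "k = Suc m" "m0 \<le> m" by (cases k) auto
  have "\<not> n < N m" using not_less_Least[of m "\<lambda>k. n < N k"] m by (simp flip: k_def)
  with m k show thesis by (intro that[of m]) auto
qed

theorem theorem2:
  fixes f :: "real \<Rightarrow> real^'r::finite \<Rightarrow> real"
    and h :: "real^('r + 'q::finite) \<Rightarrow> real^'t::finite"
    and w0 :: "real^('r + 'q)"
    and \<alpha> \<kappa>\<^sub>1 \<kappa>\<^sub>2 :: real
    and \<delta> \<epsilon> :: "nat \<Rightarrow> real"
    and N :: "nat \<Rightarrow> nat"
    and X :: "nat \<Rightarrow> (nat \<Rightarrow> real) set"
    and w_hat :: "nat \<Rightarrow> (nat \<Rightarrow> real) \<Rightarrow> real^('r + 'q)"
    and l_hat :: "nat \<Rightarrow> (nat \<Rightarrow> real) \<Rightarrow> real^'t"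
  defines "p0 \<equiv> phi_part w0"
    and "P \<equiv> P_matrix f h w0"
  assumes dims: "CARD('q) \<le> CARD('t)" "CARD('t) \<le> CARD('r)"
    and alpha: "0 < \<alpha>"
    and f_cond: "density_conditions f p0 \<alpha> \<kappa>\<^sub>1"
    and h_cond: "constraint_conditions h w0 \<alpha> \<kappa>\<^sub>2"
    and h_true: "h w0 = 0"
    and delta: "decseq \<delta>" "\<And>m. 0 < \<delta> m" "\<delta> \<longlonglongrightarrow> 0" "\<delta> 0 < \<alpha>"
    and eps: "decseq \<epsilon>" "\<And>m. 0 < \<epsilon> m" "\<epsilon> \<longlonglongrightarrow> 0" "\<epsilon> 0 < 1"
    and delta_small: "\<And>d e n Y x. 0 < d \<Longrightarrow> d \<le> \<delta> 0 \<Longrightarrow> 0 < e \<Longrightarrow> e < 1 \<Longrightarrow> 0 < n \<Longrightarrow>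
          good_sample_set f p0 \<alpha> \<kappa>\<^sub>1 d e n Y \<Longrightarrow> x \<in> Y \<Longrightarrow>
          \<exists>w l. likelihood_equations f h n x w l \<and> norm (w - w0) < d"
    and N: "strict_mono N" "0 < N 0"
    and N_good: "\<And>m n. N m \<le> n \<Longrightarrow> \<exists>Y. good_sample_set f p0 \<alpha> \<kappa>\<^sub>1 (\<delta> m) (\<epsilon> m) n Y"
    and X: "\<And>m n. N m \<le> n \<Longrightarrow> n < N (Suc m) \<Longrightarrow>
          good_sample_set f p0 \<alpha> \<kappa>\<^sub>1 (\<delta> m) (\<epsilon> m) n (X n)"
    and est_meas: "\<And>n. N 0 \<le> n \<Longrightarrow> w_hat n \<in> borel_measurable (sample_law f p0 n)"
          "\<And>n. N 0 \<le> n \<Longrightarrow> l_hat n \<in> borel_measurable (sample_law f p0 n)"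
    and est_in: "\<And>m n x. N m \<le> n \<Longrightarrow> n < N (Suc m) \<Longrightarrow> x \<in> X n \<Longrightarrow>
          likelihood_equations f h n x (w_hat n x) (l_hat n x) \<and> norm (w_hat n x - w0) < \<delta> m"
    and est_out: "\<And>n. N 0 \<le> n \<Longrightarrow> AE x in sample_law f p0 n. x \<notin> X n \<longrightarrow>
          stack (w_hat n x - w0) (l_hat n x) =
            P *v stack (stack (score f n x p0 /\<^sub>R real n) 0) 0"
  shows "\<exists>L. multivariate_normal L 0 (asymp_cov P) \<and>
           converges_weakly
             (\<lambda>n. distr (sample_law f p0 n) borel
                    (\<lambda>x. sqrt (real n) *\<^sub>R stack (w_hat n x - w0) (l_hat n x))) L"
proof -

  \<comment> \<open>Covariance algebra and existence of the limit law\<close>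
  define B where "B = fisher f p0"
  define J where "J = jacJ h w0"
  define K where "K = jacK h w0"
  define A where "A = info_block B J K"
  have P: "P = matrix_inv A"
    unfolding P_def P_matrix_def A_def B_def J_def K_def p0_def ..
  have B_sym: "transpose B = B" unfolding B_def by (rule fisher_symmetric)
  have B_pos: "0 < v \<bullet> (B *v v)" if "v \<noteq> 0" for v
    using f_cond that unfolding density_conditions_def B_def by blast
  have inv: "invertible A"
    unfolding A_def
    by (rule invertible_info_block[OF B_pos])
      (use h_cond in \<open>auto simp: constraint_conditions_def J_def K_def\<close>)
  have P_sym: "transpose P = P"
    unfolding P by (rule matrix_inv_transpose_sym[OF inv]) (simp add: A_def transpose_info_block[OF B_sym])
  \<comment> \<open>The score occupies only this first block, so every variance depends on
    \<open>u\<close> through \<open>top (P *v u)\<close> alone.\<close>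
  define top where "top z = (\<chi> i. z $ Inl (Inl i))" for z :: "real^(('r + 'q) + 't)"
  have top: "\<exists>y l. z = stack (stack (top z) y) l" for z
  proof -
    obtain a l where "z = stack a l" by (rule stack_cases)
    moreover obtain x y where "a = stack x y" by (rule stack_cases)
    ultimately show ?thesis by (auto simp: top_def vec_eq_iff)
  qed
  have quad: "u \<bullet> (asymp_cov P *v u) = top (P *v u) \<bullet> (B *v top (P *v u))" for u
  proof -
    obtain y l where z: "matrix_inv A *v u = stack (stack (top (P *v u)) y) l"
      using top[of "P *v u"] unfolding P by blast
    show ?thesis
      using asymp_cov_info_block[of B J K, folded A_def, OF inv B_sym z] unfolding P .
  qed
  have B_nonneg: "0 \<le> v \<bullet> (B *v v)" for v using B_pos[of v] by (cases "v = 0") auto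
  obtain L where L: "multivariate_normal L 0 (asymp_cov P)"
    using multivariate_normal_exists[OF transpose_asymp_cov[OF P_sym]] quad B_nonneg by metis
  have L_prob: "prob_space L" and L_sets: "sets L = sets borel"
    using L unfolding multivariate_normal_def by auto

  \<comment> \<open>Moments of the score of one observation\<close>
  obtain g :: "real \<Rightarrow> real^'r" where g: "g \<in> borel_measurable borel"
    and g_AE: "AE x in obs_law f p0. \<forall>i. has_iter_partial [i] (\<lambda>q. ln (f x q)) p0 \<and>
        g x $ i = iter_partial [i] (\<lambda>q. ln (f x q)) p0"
    and moments: "\<forall>i. integrable (obs_law f p0) (\<lambda>x. g x $ i)"
      "\<forall>i. (\<integral>x. g x $ i \<partial>obs_law f p0) = 0"
      "\<forall>i j. integrable (obs_law f p0) (\<lambda>x. g x $ i * g x $ j)"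
      "\<forall>i j. (\<integral>x. g x $ i * g x $ j \<partial>obs_law f p0) = B $ i $ j"
    by (rule measurable_score_exists[OF f_cond alpha, folded B_def])
  note g_int = moments(1)[rule_format] and g_mean = moments(2)[rule_format]
    and gg_int = moments(3)[rule_format] and gg_cov = moments(4)[rule_format]
  have obs_prob: "prob_space (obs_law f p0)"
    using f_cond alpha unfolding density_conditions_def by simp
  interpret iid_sample "obs_law f p0"
    by (rule iid_sample.intro) (rule obs_prob)
  have sample_law: "sample_law f p0 n = sample n" for n
    unfolding sample_law_def ..
  have sample_prob: "prob_space (sample n)" for n
    by (rule prob_space_PiM) (rule obs_prob)
  have obs_sets: "sets (obs_law f p0) = sets borel" by (simp add: obs_law_def)
  have g_meas [measurable]: "g \<in> borel_measurable (obs_law f p0)"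
    using g by (simp add: measurable_cong_sets[OF obs_sets refl])

  define a_g where "a_g a y = a \<bullet> g y" for a y
  have a_g_meas: "a_g a \<in> borel_measurable (obs_law f p0)" for a unfolding a_g_def by measurable
  have a_g_mean: "expectation (a_g a) = 0" for a
  proof -
    have "expectation (a_g a) = (\<Sum>i\<in>UNIV. expectation (\<lambda>y. a $ i * g y $ i))"
      unfolding a_g_def inner_vec_def inner_real_def
      by (rule Bochner_Integration.integral_sum) (use g_int in simp)
    then show ?thesis by (simp add: g_mean)
  qed
  have a_g_sq: "(a_g a y)\<^sup>2 = (\<Sum>i\<in>UNIV. \<Sum>j\<in>UNIV. a $ i * a $ j * (g y $ i * g y $ j))" for a y
    unfolding a_g_def inner_vec_def inner_real_def power2_eq_square sum_product by (simp add: mult_ac)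
  have a_g_sq_int: "integrable (obs_law f p0) (\<lambda>y. (a_g a y)\<^sup>2)" for a
    unfolding a_g_sq by (intro Bochner_Integration.integrable_sum integrable_mult_right gg_int)
  have a_g_var: "expectation (\<lambda>y. (a_g a y)\<^sup>2) = a \<bullet> (B *v a)" for a
  proof -
    have "expectation (\<lambda>y. (a_g a y)\<^sup>2) = (\<Sum>i\<in>UNIV. \<Sum>j\<in>UNIV. a $ i * a $ j * B $ i $ j)"
      unfolding a_g_sq gg_cov[symmetric]
      by (subst Bochner_Integration.integral_sum,
          (intro Bochner_Integration.integrable_sum integrable_mult_right gg_int)[1],
          intro sum.cong refl, subst Bochner_Integration.integral_sum,
          (intro integrable_mult_right gg_int)[1]) simp
    also have "\<dots> = a \<bullet> (B *v a)"
      by (simp add: inner_vec_def matrix_vector_mult_def sum_distrib_left mult_ac)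
    finally show ?thesis .
  qed

  \<comment> \<open>The normalized score and an integrable bound for its norm\<close>
  define W where "W n x = (1 / sqrt (real n)) *\<^sub>R (\<Sum>k<n. g (x k))" for n and x :: "nat \<Rightarrow> real"
  have W_meas: "W n \<in> borel_measurable (sample n)" for n
    unfolding W_def by (intro borel_measurable_scaleR sum_sample g_meas) simp
  have inner_W: "a \<bullet> W n x = (\<Sum>k<n. a_g a (x k)) / sqrt (real n)" for a n x
    by (simp add: W_def a_g_def inner_sum_right)
  \<comment> \<open>This is the l1 norm of \<open>W n x\<close>: each summand is a scalar normalized
    sum, whose first moment is already bounded uniformly in \<open>n\<close>.\<close>
  define R where "R n x = (\<Sum>i\<in>UNIV. \<bar>(\<Sum>k<n. a_g (axis i 1) (x k)) / sqrt (real n)\<bar>)" for n x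
  define C where "C = (\<Sum>i\<in>(UNIV::'r set). 1 + axis i 1 \<bullet> (B *v axis i 1))"
  have C: "0 \<le> C" unfolding C_def by (intro sum_nonneg add_nonneg_nonneg B_nonneg) simp
  have W_le: "norm (W n x) \<le> R n x" for n x
    unfolding R_def inner_W[symmetric] by (rule order_trans[OF norm_le_l1_cart]) (simp add: inner_axis')
  have R_int: "integrable (sample n) (R n)" for n
    unfolding R_def
    by (intro Bochner_Integration.integrable_sum abs_normalized_sum_le(1) a_g_meas a_g_sq_int a_g_mean)
  have R_le: "(\<integral>x. R n x \<partial>sample n) \<le> C" for n
  proof -
    have "(\<integral>x. R n x \<partial>sample n)
        = (\<Sum>i\<in>UNIV. \<integral>x. \<bar>(\<Sum>k<n. a_g (axis i 1) (x k)) / sqrt (real n)\<bar> \<partial>sample n)"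
      unfolding R_def
      by (rule Bochner_Integration.integral_sum) (intro abs_normalized_sum_le(1) a_g_meas a_g_sq_int a_g_mean)
    also have "\<dots> \<le> C"
      unfolding C_def a_g_var[symmetric]
      by (intro sum_mono abs_normalized_sum_le(2) a_g_meas a_g_sq_int a_g_mean)
    finally show ?thesis .
  qed
  have score_AE: "AE x in sample n. score f n x p0 = (\<Sum>k<n. g (x k))" for n
  proof -
    have "AE x in sample n. \<forall>k\<in>{..<n}. \<forall>i. has_iter_partial [i] (\<lambda>q. ln (f (x k) q)) p0 \<and>
        g (x k) $ i = iter_partial [i] (\<lambda>q. ln (f (x k) q)) p0"
      by (rule AE_sample[OF g_AE])
    then show ?thesis
    proof eventually_elim
      case (elim x)
      show ?case by (rule score_eq_sum) (use elim in blast)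
    qed
  qed

  \<comment> \<open>The scaled estimator and its linear approximation\<close>
  define T where "T n x = sqrt (real n) *\<^sub>R stack (w_hat n x - w0) (l_hat n x)" for n x
  define V where "V n x = P *v stack (stack (W n x) 0) 0" for n x
  have V_meas: "V n \<in> borel_measurable (sample n)" for n
    unfolding V_def by (intro measurable_matrix_vector_mult measurable_stack W_meas) simp_all
  have T_meas: "T n \<in> borel_measurable (sample n)" if "N 0 \<le> n" for n
    unfolding T_def using est_meas[OF that] unfolding sample_law
    by (intro borel_measurable_scaleR measurable_stack borel_measurable_diff) simp_all
  have inner_V: "u \<bullet> V n x = top (P *v u) \<bullet> W n x" for u n x
  proof -
    obtain y l where z: "P *v u = stack (stack (top (P *v u)) y) l" using top by blast
    have "u \<bullet> V n x = (P *v u) \<bullet> stack (stack (W n x) 0) 0"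
      unfolding V_def by (metis P_sym matrix_transpose_inner)
    also have "\<dots> = top (P *v u) \<bullet> W n x" by (subst z) simp
    finally show ?thesis .
  qed

  obtain c where c: "0 \<le> c" "\<And>z. norm (P *v z) \<le> c * norm z"
  proof -
    have "bounded_linear ((*v) P)" by (simp add: linear_conv_bounded_linear[symmetric])
    from bounded_linear.nonneg_bounded[OF this] show thesis using that by (auto simp: mult.commute)
  qed
  \<comment> \<open>The constant of the linearization; the absolute value makes it nonnegative
    without determining the signs of \<open>\<kappa>\<^sub>1\<close> and
    \<open>\<kappa>\<^sub>2\<close>.\<close>
  define E where "E = \<bar>real CARD(('r + 'q) + 't) * (2 * \<kappa>\<^sub>1 * (real CARD('r))\<^sup>2 + real CARD('r)
        + 2 * \<kappa>\<^sub>2 * real CARD('r + 'q) * real CARD('t) + 2 * \<kappa>\<^sub>2 * (real CARD('r + 'q))\<^sup>2)\<bar>"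
  have close: "\<forall>\<^sub>F n in sequentially. N 0 \<le> n \<and> (AE x in sample n. norm (T n x - V n x) \<le> \<eta> * R n x)"
    if "0 < \<eta>" for \<eta>
  proof -
    have lim: "(\<lambda>m. c * (E * \<delta> m)) \<longlonglongrightarrow> c * (E * 0)" "(\<lambda>m. 2 * c\<^sup>2 * (E * \<delta> m)) \<longlonglongrightarrow> 2 * c\<^sup>2 * (E * 0)"
      by (intro tendsto_intros delta)+
    \<comment> \<open>The first bound is what absorbing the residual requires; the second makes the
      resulting error at most \<open>\<eta>\<close> times the norm of the averaged score.\<close>
    have "\<forall>\<^sub>F m in sequentially. c * (E * \<delta> m) < 1/2" "\<forall>\<^sub>F m in sequentially. 2 * c\<^sup>2 * (E * \<delta> m) < \<eta>"
      using order_tendstoD(2)[OF lim(1), of "1/2"] order_tendstoD(2)[OF lim(2), of \<eta>] \<open>0 < \<eta>\<close> by auto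
    then have "\<forall>\<^sub>F m in sequentially. c * (E * \<delta> m) < 1/2 \<and> 2 * c\<^sup>2 * (E * \<delta> m) < \<eta>"
      by (rule eventually_conj)
    then obtain m0 where m0: "\<And>m. m0 \<le> m \<Longrightarrow> c * (E * \<delta> m) < 1/2 \<and> 2 * c\<^sup>2 * (E * \<delta> m) < \<eta>"
      unfolding eventually_sequentially by blast
    show ?thesis
    proof (rule eventually_sequentiallyI[of "N m0"], rule conjI)
      fix n assume n: "N m0 \<le> n"
      have "N 0 \<le> N m0" using N(1) by (simp add: strict_mono_less_eq)
      with n show n0: "N 0 \<le> n" by simp
      then have pos: "0 < n" using N(2) by simp
      obtain m where m: "m0 \<le> m" "N m \<le> n" "n < N (Suc m)" using strict_mono_bracket[OF N(1) n] .
      have good: "good_sample_set f p0 \<alpha> \<kappa>\<^sub>1 (\<delta> m) (\<epsilon> m) n (X n)" by (rule X[OF m(2,3)])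
      have \<delta>m: "0 < \<delta> m" "\<delta> m \<le> \<alpha>"
        using delta(2)[of m] delta(4) decseqD[OF delta(1), of 0 m] by auto
      have sqrt_n: "sqrt (real n) * inverse (real n) = 1 / sqrt (real n)"
        using pos by (simp add: field_simps)
      have scaled: "sqrt (real n) *\<^sub>R (P *v stack (stack (score f n x p0 /\<^sub>R real n) 0) 0) = V n x"
        if "score f n x p0 = (\<Sum>k<n. g (x k))" for x
        unfolding V_def W_def that
        by (simp only: matrix_vector_mult_scaleR[symmetric] scaleR_stack scaleR_zero_right scaleR_scaleR sqrt_n)
      show "AE x in sample n. norm (T n x - V n x) \<le> \<eta> * R n x"
        using score_AE est_out[OF n0, unfolded sample_law]
      proof eventually_elim
        case (elim x)
        note V_eq = scaled[OF elim(1)]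
        have R0: "0 \<le> R n x" using W_le[of n x] norm_ge_zero order_trans by blast
        show ?case
        proof (cases "x \<in> X n")
          case False
          then have "T n x = V n x" using elim(2) by (simp add: T_def V_eq)
          then show ?thesis using R0 \<open>0 < \<eta>\<close> by simp
        next
          case True
          let ?z = "stack (w_hat n x - w0) (l_hat n x)"
          let ?S = "stack (stack (score f n x p0 /\<^sub>R real n) 0) 0 :: real^(('r + 'q) + 't)"
          have eqs: "likelihood_equations f h n x (w_hat n x) (l_hat n x)" "norm (w_hat n x - w0) < \<delta> m"
            using est_in[OF m(2,3) True] by auto
          have diff: "\<And>q i j k. q \<in> cball p0 \<alpha> \<Longrightarrow> has_iter_partial [i, j, k] (loglik f n x) q"
            and third: "\<And>q i j k. q \<in> cball p0 \<alpha> \<Longrightarrow>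
              \<bar>iter_partial [i, j, k] (loglik f n x) q / real n\<bar> < 2 * \<kappa>\<^sub>1"
            and "\<exists>M :: real^'r^'r. (\<forall>i j. \<bar>M $ i $ j\<bar> \<le> 1) \<and>
              hess f n x p0 /\<^sub>R real n = - fisher f p0 + \<delta> m *\<^sub>R M"
            using good True unfolding good_sample_set_def
            by (auto simp del: has_iter_partial.simps iter_partial.simps)
          then obtain M :: "real^'r^'r" where M: "\<And>i j. \<bar>M $ i $ j\<bar> \<le> 1"
              "hess f n x p0 /\<^sub>R real n = - fisher f p0 + \<delta> m *\<^sub>R M" by blast
          have "norm (A *v ?z - ?S) \<le> real CARD(('r + 'q) + 't) * (2 * \<kappa>\<^sub>1 * (real CARD('r))\<^sup>2 + real CARD('r)
              + 2 * \<kappa>\<^sub>2 * real CARD('r + 'q) * real CARD('t) + 2 * \<kappa>\<^sub>2 * (real CARD('r + 'q))\<^sup>2) * \<delta> m * norm ?z"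
            unfolding A_def B_def J_def K_def p0_def
            by (rule likelihood_equations_linearized[OF pos h_cond h_true diff[unfolded p0_def]
                  third[unfolded p0_def] M(1) M(2)[unfolded p0_def] eqs(1) less_imp_le[OF eqs(2)] \<delta>m(2)])
          also have "\<dots> \<le> E * \<delta> m * norm ?z"
            unfolding E_def using \<delta>m(1) by (intro mult_right_mono abs_ge_self) auto
          finally have resid: "norm (A *v ?z - ?S) \<le> (E * \<delta> m) * norm ?z" .
          have "norm (?z - P *v ?S) \<le> 2 * c\<^sup>2 * (E * \<delta> m) * norm ?S"
            by (rule perturbed_linear_solution[OF _ c(2) c(1) resid])
              (use m0[OF m(1)] \<delta>m(1) matrix_inv(2)[OF inv] in \<open>auto simp: P E_def\<close>)
          also have "\<dots> \<le> \<eta> * norm ?S"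
            using m0[OF m(1)] by (intro mult_right_mono) auto
          finally have *: "norm (?z - P *v ?S) \<le> \<eta> * norm ?S" .
          have "T n x - V n x = sqrt (real n) *\<^sub>R (?z - P *v ?S)"
            unfolding T_def V_eq[symmetric] by (simp add: scaleR_diff_right)
          then have "norm (T n x - V n x) \<le> sqrt (real n) * (\<eta> * norm ?S)"
            using mult_left_mono[OF *, of "sqrt (real n)"] by simp
          also have "sqrt (real n) * (\<eta> * norm ?S)
              = \<eta> * ((sqrt (real n) * inverse (real n)) * norm (\<Sum>k<n. g (x k)))"
            unfolding elim(1) norm_stack_zero norm_scaleR by (simp add: mult_ac)
          also have "\<dots> = \<eta> * norm (W n x)"
            unfolding sqrt_n W_def norm_scaleR by simp
          also have "\<dots> \<le> \<eta> * R n x" using \<open>0 < \<eta>\<close> W_le by (intro mult_left_mono) auto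
          finally show ?thesis .
        qed
      qed
    qed
  qed

  \<comment> \<open>Limit of the characteristic functions\<close>
  have char_V: "(\<lambda>n. CLINT x|sample n. iexp (u \<bullet> V n x))
      \<longlonglongrightarrow> complex_of_real (exp (- (u \<bullet> (asymp_cov P *v u)) / 2))" for u
  proof (cases "top (P *v u) = 0")
    \<comment> \<open>In such a direction the projection of \<open>V\<close> is identically 0 and so
      is the limiting variance; the central limit theorem is applied only with positive
      variance.\<close>
    case True
    then show ?thesis
      unfolding quad inner_V by (simp add: prob_space.prob_space[OF sample_prob])
  next
    case False
    show ?thesis
      unfolding quad inner_V inner_W a_g_var[symmetric]
      by (rule char_normalized_sum_tendsto[OF a_g_meas a_g_sq_int a_g_mean])
        (unfold a_g_var, rule B_pos[OF False])
  qed
  have char_T: "(\<lambda>n. CLINT x|sample n. iexp (u \<bullet> T n x)) \<longlonglongrightarrow> (CLINT x|L. iexp (u \<bullet> x))" for u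
  proof -
    have "(\<lambda>n. (CLINT x|sample n. iexp (u \<bullet> T n x)) - (CLINT x|sample n. iexp (u \<bullet> V n x))) \<longlonglongrightarrow> 0"
    proof (rule tendstoI)
      fix e :: real assume "0 < e"
      \<comment> \<open>Makes \<open>norm u * \<eta> * C\<close> smaller than \<open>e\<close>; the
        added 1 keeps the denominator positive when \<open>u\<close> or \<open>C\<close>
        vanishes.\<close>
      define \<eta> where "\<eta> = e / (1 + norm u * C)"
      have pos: "0 < 1 + norm u * C" using C by (simp add: add_pos_nonneg)
      then have \<eta>: "0 < \<eta>" using \<open>0 < e\<close> by (simp add: \<eta>_def)
      have less: "norm u * \<eta> * C < e"
      proof -
        have "norm u * \<eta> * C < \<eta> * (1 + norm u * C)" using \<eta> by (simp add: algebra_simps)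
        then show ?thesis using pos by (simp add: \<eta>_def)
      qed
      from close[OF \<eta>] show "\<forall>\<^sub>F n in sequentially.
          dist ((CLINT x|sample n. iexp (u \<bullet> T n x)) - (CLINT x|sample n. iexp (u \<bullet> V n x))) 0 < e"
      proof eventually_elim
        case (elim n)
        then have "norm ((CLINT x|sample n. iexp (u \<bullet> T n x)) - (CLINT x|sample n. iexp (u \<bullet> V n x)))
            \<le> norm u * \<eta> * C"
          using \<eta> by (intro prob_space.char_perturbation[OF sample_prob T_meas V_meas _ R_int R_le]) auto
        with less show ?case by (simp only: dist_0_norm dist_commute[of _ 0])
      qed
    qed
    from tendsto_add[OF this char_V[of u]] show ?thesis
      by (simp add: multivariate_normal_trig[OF L])
  qed

  \<comment> \<open>Weak convergence of the scaled estimators\<close>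
  have T_ev: "\<forall>\<^sub>F n in sequentially. T n \<in> borel_measurable (sample n)"
    by (rule eventually_sequentiallyI[of "N 0"]) (rule T_meas)
  have id_L: "(\<lambda>x. x) \<in> borel_measurable L"
    by (simp add: measurable_cong_sets[OF L_sets refl])
  have "converges_weakly (\<lambda>n. distr (sample n) borel (T n)) L"
  proof (rule levy_continuity_euclidean)
    show "\<forall>\<^sub>F n in sequentially. prob_space (distr (sample n) borel (T n)) \<and> sets (distr (sample n) borel (T n)) = sets borel"
      using T_ev by eventually_elim (auto intro: prob_space.prob_space_distr sample_prob)
    show "prob_space L" "sets L = sets borel" by (fact L_prob L_sets)+
    show "(\<lambda>n. \<integral>x. cos (u \<bullet> x) \<partial>distr (sample n) borel (T n)) \<longlonglongrightarrow> (\<integral>x. cos (u \<bullet> x) \<partial>L)" for u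
    proof -
      have "\<forall>\<^sub>F n in sequentially. Re (CLINT x|sample n. iexp (u \<bullet> T n x)) = (\<integral>x. cos (u \<bullet> x) \<partial>distr (sample n) borel (T n))"
        using T_ev
        by eventually_elim
          (subst integral_distr, auto simp: prob_space.integral_cos_sin_eq_Re_Im(1)[OF sample_prob])
      with tendsto_Re[OF char_T[of u]] show ?thesis
        unfolding prob_space.integral_cos_sin_eq_Re_Im(1)[OF L_prob id_L] by (rule Lim_transform_eventually)
    qed
    show "(\<lambda>n. \<integral>x. sin (u \<bullet> x) \<partial>distr (sample n) borel (T n)) \<longlonglongrightarrow> (\<integral>x. sin (u \<bullet> x) \<partial>L)" for u
    proof -
      have "\<forall>\<^sub>F n in sequentially. Im (CLINT x|sample n. iexp (u \<bullet> T n x)) = (\<integral>x. sin (u \<bullet> x) \<partial>distr (sample n) borel (T n))"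
        using T_ev
        by eventually_elim
          (subst integral_distr, auto simp: prob_space.integral_cos_sin_eq_Re_Im(2)[OF sample_prob])
      with tendsto_Im[OF char_T[of u]] show ?thesis
        unfolding prob_space.integral_cos_sin_eq_Re_Im(2)[OF L_prob id_L] by (rule Lim_transform_eventually)
    qed
    fix e :: real assume e: "0 < e"
    \<comment> \<open>With tolerance 1 the norm of \<open>T\<close> is at most
      \<open>(c + 1) * R\<close>, where \<open>c\<close> accounts for \<open>V\<close> and 1 for the
      difference. Its mean is at most \<open>(c + 1) * C\<close>; the extra 1 in the numerator makes
      the final inequality strict.\<close>
    define r where "r = ((c + 1) * C + 1) / e"
    have num: "0 < (c + 1) * C + 1" using c(1) C by (intro add_nonneg_pos mult_nonneg_nonneg) auto
    then have r: "0 < r" using e by (simp add: r_def)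
    have "(c + 1) * C / r < e"
      using num e by (simp add: r_def field_simps)
    have "\<forall>\<^sub>F n in sequentially. measure (distr (sample n) borel (T n)) (UNIV - cball 0 r) < e"
      using close[of 1, OF zero_less_one]
    proof eventually_elim
      case (elim n)
      have "AE x in sample n. norm (T n x) \<le> (c + 1) * R n x"
        using conjunct2[OF elim]
      proof eventually_elim
        case (elim x)
        have "norm (V n x) \<le> c * norm (W n x)"
          unfolding V_def using c(2)[of "stack (stack (W n x) 0) 0"] by simp
        also have "\<dots> \<le> c * R n x" using c(1) W_le by (rule mult_left_mono[rotated])
        finally show ?case
          using elim norm_triangle_sub[of "T n x" "V n x"] unfolding distrib_right by linarith
      qed
      then have "measure (distr (sample n) borel (T n)) (UNIV - cball 0 r) \<le> ((c + 1) * C) / r"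
      proof (rule prob_space.prob_norm_gt_le[OF sample_prob T_meas[OF conjunct1[OF elim]] _ _ _ r])
        show "integrable (sample n) (\<lambda>x. (c + 1) * R n x)" using R_int by simp
        show "(\<integral>x. (c + 1) * R n x \<partial>sample n) \<le> (c + 1) * C"
          using R_le[of n] c(1) by (simp add: mult_left_mono)
      qed
      with \<open>(c + 1) * C / r < e\<close> show ?case by linarith
    qed
    then show "\<exists>r. \<forall>\<^sub>F n in sequentially. measure (distr (sample n) borel (T n)) (UNIV - cball 0 r) < e"
      by blast
  qed
  then show ?thesis
    using L unfolding T_def sample_law by blast
qed

end
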